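(* Let $\mathbb{X}$ be a Polish space and let $\mathcal{B}_b\subseteq\mathcal{B}(\mathbb{X})$ be a boundedness which properly localizes $\mathbb{X}$. Then the space $\mathcal{M}(\mathbb{X})$ of all locally finite Borel measures on $\mathbb{X}$, equipped with the vague topology, is metrizable and hence Polish.
   Context: A Polish space is a separable topological space which is metrizable by a complete metric; $\mathcal{B}(\mathbb{X})$ denotes the Borel $\sigma$-field of $\mathbb{X}$. A family $\mathcal{B}_b\subseteq\mathcal{B}(\mathbb{X})$ is a (Borel) boundedness in $\mathbb{X}$ if (i) $A\subseteq B\in\mathcal{B}_b$ with $A\in\mathcal{B}(\mathbb{X})$ implies $A\in\mathcal{B}_b$, and (ii) $A,B\in\mathcal{B}_b$ implies $A\cup B\in\mathcal{B}_b$. The elements of $\mathcal{B}_b$ are called bounded sets. A subfamily $\mathcal{C}_b\subseteq\mathcal{B}_b$ is a basis of $\mathcal{B}_b$ if every $B\in\mathcal{B}_b$ is contained in some $C\in\mathcal{C}_b$. The boundedness $\mathcal{B}_b$ is proper if for each $B\in\mathcal{B}_b$ there exists an open set $U\in\mathcal{B}_b$ with $\overline{B}\subseteq U$, where $\overline{B}$ is the closure of $B$. It properly localizes $\mathbb{X}$ if it is proper and has a countable basis which covers $\mathbb{X}$. A Borel measure $\mu$ on $\mathbb{X}$ is locally finite if $\mu(B)<\infty$ for all $B\in\mathcal{B}_b$; $\mathcal{M}(\mathbb{X})=\mathcal{M}(\mathbb{X},\mathcal{B}_b)$ is the set of all such measures. $CB_b^+(\mathbb{X})$ is the family of all nonnegative,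 bounded, continuous real-valued functions on $\mathbb{X}$ whose support is a bounded set (i.e. belongs to $\mathcal{B}_b$). Write $\mu(f)=\int f\,d\mu$. The vague topology on $\mathcal{M}(\mathbb{X})$ is the smallest topology under which the maps $\mu\mapsto\mu(f)$ are continuous for all $f\in CB_b^+(\mathbb{X})$. *)

theory Defs
  imports "HOL-Analysis.Analysis"
begin

definition boundedness :: "'a::topological_space set set \<Rightarrow> bool" where
  "boundedness \<B> \<longleftrightarrow>
     \<B> \<subseteq> sets borel \<and>
     (\<forall>A B. A \<in> sets borel \<and> A \<subseteq> B \<and> B \<in> \<B> \<longrightarrow> A \<in> \<B>) \<and>
     (\<forall>A B. A \<in> \<B> \<and> B \<in> \<B> \<longrightarrow> A \<union> B \<in> \<B>)"

definition boundedness_basis :: "'a set set \<Rightarrow> 'a set set \<Rightarrow> bool" where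
  "boundedness_basis \<B> \<C> \<longleftrightarrow> \<C> \<subseteq> \<B> \<and> (\<forall>B\<in>\<B>. \<exists>C\<in>\<C>. B \<subseteq> C)"

definition proper_boundedness :: "'a::topological_space set set \<Rightarrow> bool" where
  "proper_boundedness \<B> \<longleftrightarrow> (\<forall>B\<in>\<B>. \<exists>U\<in>\<B>. open U \<and> closure B \<subseteq> U)"

definition properly_localizes :: "'a::topological_space set set \<Rightarrow> bool" where
  "properly_localizes \<B> \<longleftrightarrow>
     proper_boundedness \<B> \<and>
     (\<exists>\<C>. countable \<C> \<and> boundedness_basis \<B> \<C> \<and> \<Union>\<C> = UNIV)"

definition locally_finite_measures :: "'a::topological_space set set \<Rightarrow> 'a measure set" where
  "locally_finite_measures \<B> =
     {\<mu>. sets \<mu> = sets borel \<and> (\<forall>B\<in>\<B>. emeasure \<mu> B < \<infinity>)}"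

text \<open>The class $CB_b^+$; the word ``bounded'' refers to the usual metric of the reals for the
  range of \<open>f\<close>, and to the boundedness \<open>\<B>\<close> for its (closed) support.\<close>

definition CBb_plus :: "'a::topological_space set set \<Rightarrow> ('a \<Rightarrow> real) set" where
  "CBb_plus \<B> =
     {f. (\<forall>x. 0 \<le> f x) \<and> bounded (range f) \<and> continuous_on UNIV f \<and>
         closure {x. f x \<noteq> 0} \<in> \<B>}"

text \<open>The initial topology, given by its canonical subbasis. The whole space is inserted
  only to make the underlying set right when there are no test functions at all. The two lemmas
  below confirm that this is the smallest topology making all \<open>\<mu> \<mapsto> \<mu>(f)\<close> continuous.\<close>

definition vague_topology :: "'a::topological_space set set \<Rightarrow> 'a measure topology" where
  "vague_topology \<B> = topology_generated_by
     (insert (locally_finite_measures \<B>)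
       {{\<mu> \<in> locally_finite_measures \<B>. (\<integral>x. f x \<partial>\<mu>) \<in> U} | f U. f \<in> CBb_plus \<B> \<and> open U})"

lemma topspace_vague_topology [simp]:
  "topspace (vague_topology \<B>) = locally_finite_measures \<B>"
  unfolding vague_topology_def topology_generated_by_topspace by auto

lemma continuous_map_vague_topology:
  assumes "f \<in> CBb_plus \<B>"
  shows "continuous_map (vague_topology \<B>) euclideanreal (\<lambda>\<mu>. \<integral>x. f x \<partial>\<mu>)"
proof -
  have "openin (vague_topology \<B>) {\<mu> \<in> locally_finite_measures \<B>. (\<integral>x. f x \<partial>\<mu>) \<in> U}"
    if "open U" for U
    unfolding vague_topology_def
    by (rule topology_generated_by_Basis) (use assms that in blast)
  then show ?thesis
    by (simp add: continuous_map)
qed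

lemma vague_topology_smallest:
  assumes T: "topspace T = locally_finite_measures \<B>"
    and cont: "\<And>f. f \<in> CBb_plus \<B> \<Longrightarrow> continuous_map T euclideanreal (\<lambda>\<mu>. \<integral>x. f x \<partial>\<mu>)"
    and V: "openin (vague_topology \<B>) V"
  shows "openin T V"
proof -
  have sub: "openin T {\<mu> \<in> locally_finite_measures \<B>. (\<integral>x. f x \<partial>\<mu>) \<in> U}"
    if "f \<in> CBb_plus \<B>" "open U" for f U
    using cont[OF that(1)] that(2) T by (simp add: continuous_map)
  have "continuous_map T (vague_topology \<B>) id"
    unfolding vague_topology_def
  proof (rule continuous_on_generated_topo)
    fix W
    assume "W \<in> insert (locally_finite_measures \<B>)
       {{\<mu> \<in> locally_finite_measures \<B>. (\<integral>x. f x \<partial>\<mu>) \<in> U} | f U. f \<in> CBb_plus \<B> \<and> open U}"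
    then have "openin T W"
      using sub T openin_topspace[of T] by auto
    then show "openin T (id -` W \<inter> topspace T)"
      by (simp add: openin_subset inf.absorb1)
  qed (use T in auto)
  moreover have "V \<subseteq> topspace T"
    using openin_subset[OF V] T by simp
  ultimately show ?thesis
    using V openin_continuous_map_preimage[of T "vague_topology \<B>" id V]
    by (simp add: inf.absorb2 Collect_conj_eq)
qed

definition polish_topology :: "'a topology \<Rightarrow> bool" where
  "polish_topology T \<longleftrightarrow> separable_space T \<and> completely_metrizable_space T"

end

theory Submission
  imports Defs
begin

text \<open>
  A countable family \<open>P\<close> of test functions, closed under sums, truncated differences and truncation at
  rational constants, approximates every test function pointwise from below. Hence the vague
  topology is the initial topology of the countably many maps \<open>\<mu> \<mapsto> \<mu>(p)\<close>, which embed the space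
  of locally finite measures into the Polish space of real sequences. The image consists of the
  nonnegative additive functionals \<open>L\<close> on \<open>P\<close> that are tight: for every cutoff \<open>g n\<close> and scale \<open>j\<close>,
  the functions \<open>min (g n) (j * dist(\<cdot>, {s 0, \<dots>, s k}))\<close>, with \<open>s\<close> a dense sequence, have \<open>L\<close>-values
  with infimum \<open>0\<close> over \<open>k\<close>. By completeness of the metric, tightness forces Daniell's
  continuity condition, so such an \<open>L\<close> is integration against a measure. Nonnegativity and additivity
  are closed conditions and tightness is a countable intersection of open ones, so the image is a
  \<open>G_\<delta>\<close> set, hence Polish.
\<close>

section \<open>The measure of a Daniell functional\<close>

lemma suminf_halves:
  assumes "0 \<le> c"
  shows "(\<Sum>i. ennreal (c * (1/2) ^ Suc i)) = ennreal c"
proof (rule suminf_ennreal_eq)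
  show "(\<lambda>i. c * (1/2) ^ Suc i) sums c"
    using sums_mult[OF power_half_series, of c] by simp
qed (use assms in auto)

text \<open>A countable substitute for a vector lattice satisfying Stone's condition: truncated
  differences stand in for subtraction and yield minima and maxima, multiples are integral, and
  truncation levels are rational, so that a countable family can have all these closure
  properties.\<close>

locale truncation_cone =
  fixes P :: "('a \<Rightarrow> real) set"
  assumes zero: "(\<lambda>_. 0) \<in> P"
    and add: "f \<in> P \<Longrightarrow> g \<in> P \<Longrightarrow> (\<lambda>x. f x + g x) \<in> P"
    and monus: "f \<in> P \<Longrightarrow> g \<in> P \<Longrightarrow> (\<lambda>x. max 0 (f x - g x)) \<in> P"
    and trunc: "f \<in> P \<Longrightarrow> q \<in> \<rat> \<Longrightarrow> 0 \<le> q \<Longrightarrow> (\<lambda>x. min (f x) q) \<in> P"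
    and nonneg: "f \<in> P \<Longrightarrow> 0 \<le> f x"
begin

lemma diff:
  assumes "f \<in> P" "g \<in> P" "\<And>x. g x \<le> f x"
  shows "(\<lambda>x. f x - g x) \<in> P"
proof -
  have "(\<lambda>x. f x - g x) = (\<lambda>x. max 0 (f x - g x))"
    using assms(3) by (auto simp: fun_eq_iff)
  then show ?thesis
    using monus[OF assms(1,2)] by simp
qed

lemma minimum:
  assumes "f \<in> P" "g \<in> P"
  shows "(\<lambda>x. min (f x) (g x)) \<in> P"
proof -
  have "(\<lambda>x. min (f x) (g x)) = (\<lambda>x. f x - max 0 (f x - g x))"
    by (auto simp: fun_eq_iff)
  moreover have "\<dots> \<in> P"
    using assms nonneg by (intro diff monus) auto
  ultimately show ?thesis by simp
qed

lemma maximum: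
  assumes "f \<in> P" "g \<in> P"
  shows "(\<lambda>x. max (f x) (g x)) \<in> P"
proof -
  have "(\<lambda>x. max (f x) (g x)) = (\<lambda>x. f x + max 0 (g x - f x))"
    by (auto simp: fun_eq_iff)
  then show ?thesis
    using add[OF assms(1) monus[OF assms(2,1)]] by simp
qed

lemma sum_closed:
  assumes "\<And>i. i \<in> I \<Longrightarrow> h i \<in> P"
  shows "(\<lambda>x. \<Sum>i\<in>I. h i x) \<in> P"
  using assms by (induction I rule: infinite_finite_induct) (auto simp: zero add)

lemma scale:
  assumes "f \<in> P"
  shows "(\<lambda>x. real n * f x) \<in> P"
  using sum_closed[of "{..<n}" "\<lambda>_. f"] assms by simp

end

locale additive_functional = truncation_cone P
  for P :: "('a \<Rightarrow> real) set" +
  fixes L :: "('a \<Rightarrow> real) \<Rightarrow> real"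
  assumes L_nonneg: "f \<in> P \<Longrightarrow> 0 \<le> L f"
    and L_add: "f \<in> P \<Longrightarrow> g \<in> P \<Longrightarrow> L (\<lambda>x. f x + g x) = L f + L g"
begin

lemma L_zero: "L (\<lambda>_. 0) = 0"
  using L_add[OF zero zero] by simp

lemma L_diff:
  assumes "f \<in> P" "g \<in> P" "\<And>x. g x \<le> f x"
  shows "L (\<lambda>x. f x - g x) = L f - L g"
  using L_add[OF diff[OF assms] assms(2)] by simp

lemma L_mono:
  assumes "f \<in> P" "g \<in> P" "\<And>x. f x \<le> g x"
  shows "L f \<le> L g"
  using L_diff[OF assms(2,1,3)] L_nonneg[OF diff[OF assms(2,1,3)]] by simp

lemma L_sum:
  assumes "\<And>i. i \<in> I \<Longrightarrow> h i \<in> P"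
  shows "L (\<lambda>x. \<Sum>i\<in>I. h i x) = (\<Sum>i\<in>I. L (h i))"
  using assms by (induction I rule: infinite_finite_induct) (auto simp: L_zero L_add sum_closed)

lemma L_scale:
  assumes "f \<in> P"
  shows "L (\<lambda>x. real n * f x) = real n * L f"
  using L_sum[of "{..<n}" "\<lambda>_. f"] assms by simp

end

text \<open>By \<open>base\<close> and countability of \<open>P\<close>, every open set is a
  countable union of sets \<open>{x. f x > 0}\<close>, which brings all Borel sets into reach of
  Caratheodory's method. Boundedness keeps layer-cake sums finite.\<close>

locale daniell_functional = additive_functional P L
  for P :: "('a::topological_space \<Rightarrow> real) set" and L +
  assumes L_daniell: "\<lbrakk>\<And>i. F i \<in> P; \<And>x. decseq (\<lambda>i. F i x); \<And>x. (\<lambda>i. F i x) \<longlonglongrightarrow> 0\<rbrakk>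
          \<Longrightarrow> (\<lambda>i. L (F i)) \<longlonglongrightarrow> 0"
    and bdd: "f \<in> P \<Longrightarrow> \<exists>C. \<forall>x. f x \<le> C"
    and cont: "f \<in> P \<Longrightarrow> continuous_on UNIV f"
    and countable_P: "countable P"
    and base: "open W \<Longrightarrow> x \<in> W \<Longrightarrow> \<exists>f\<in>P. f x > 0 \<and> {x. f x > 0} \<subseteq> W"
begin

text \<open>The uncovered remainders \<open>F n\<close> decrease pointwise to 0, so
  \<open>L (F n)\<close> tends to 0 by the Daniell condition, while \<open>e\<close> is at most
  \<open>F n\<close> plus the \<open>n\<close>-th partial sum.\<close>

lemma L_le_suminf:
  assumes e: "e \<in> P" and h: "\<And>i. h i \<in> P"
    and le: "\<And>x. ennreal (e x) \<le> (\<Sum>i. ennreal (h i x))"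
  shows "ennreal (L e) \<le> (\<Sum>i. ennreal (L (h i)))"
proof -
  define F where "F n = (\<lambda>x. max 0 (e x - (\<Sum>i<n. h i x)))" for n
  have F: "F n \<in> P" for n
    unfolding F_def by (intro monus e sum_closed h)
  have "(\<lambda>n. L (F n)) \<longlonglongrightarrow> 0"
  proof (rule L_daniell[OF F])
    show "decseq (\<lambda>i. F i x)" for x
    proof (rule decseq_SucI)
      show "F (Suc n) x \<le> F n x" for n
        using nonneg[OF h, of n x] by (simp add: F_def)
    qed
    show "(\<lambda>n. F n x) \<longlonglongrightarrow> 0" for x
    proof (rule LIMSEQ_I)
      fix r :: real assume "r > 0"
      have "\<exists>n. e x - r < (\<Sum>i<n. h i x)"
      \<comment> \<open>If \<open>e x < r\<close>, the empty sum suffices; otherwise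
        \<open>e x - r\<close> is nonnegative and the comparison can be made in
        \<open>ennreal\<close>.\<close>
      proof (cases "e x < r")
        case False
        have "ennreal (e x - r) < ennreal (e x)"
          using False \<open>r > 0\<close> by (simp add: ennreal_less_iff)
        also have "\<dots> \<le> (SUP n. (\<Sum>i<n. ennreal (h i x)))"
          using le[of x] by (simp add: suminf_eq_SUP)
        finally obtain n where "ennreal (e x - r) < (\<Sum>i<n. ennreal (h i x))"
          by (auto simp: less_SUP_iff)
        then have "ennreal (e x - r) < ennreal (\<Sum>i<n. h i x)"
          using nonneg[OF h] by (simp add: sum_ennreal)
        then show ?thesis
          using False by (auto simp: ennreal_less_iff)
      qed (auto intro!: exI[of _ 0])
      then obtain n where n: "e x - r < (\<Sum>i<n. h i x)" by blast
      have "norm (F k x - 0) < r" if "k \<ge> n" for k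
      proof -
        have "(\<Sum>i<n. h i x) \<le> (\<Sum>i<k. h i x)"
          using that nonneg[OF h] by (intro sum_mono2) auto
        then show ?thesis using n \<open>r > 0\<close> by (auto simp: F_def)
      qed
      then show "\<exists>n. \<forall>k\<ge>n. norm (F k x - 0) < r" by blast
    qed
  qed
  then have lim: "(\<lambda>n. ennreal (L (F n)) + (\<Sum>i<n. ennreal (L (h i))))
      \<longlonglongrightarrow> ennreal 0 + (\<Sum>i. ennreal (L (h i)))"
    by (intro tendsto_add tendsto_ennrealI summable_LIMSEQ) auto
  have bound: "ennreal (L e) \<le> ennreal (L (F n)) + (\<Sum>i<n. ennreal (L (h i)))" for n
  proof -
    have "L e \<le> L (\<lambda>x. F n x + (\<Sum>i<n. h i x))"
      by (rule L_mono) (auto simp: e F_def intro!: add monus sum_closed h)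
    also have "\<dots> = L (F n) + (\<Sum>i<n. L (h i))"
      using L_add[OF F[of n] sum_closed[of "{..<n}" h]] L_sum[of "{..<n}" h] h by simp
    finally have "ennreal (L e) \<le> ennreal (L (F n) + (\<Sum>i<n. L (h i)))"
      by (rule ennreal_leI)
    then show ?thesis
      using L_nonneg[OF F[of n]] L_nonneg[OF h] by (simp add: sum_ennreal sum_nonneg ennreal_plus)
  qed
  show ?thesis
    using tendsto_lowerbound[OF lim, of "ennreal (L e)"] bound by auto
qed

section \<open>The outer measure of a Daniell functional\<close>

definition covers :: "'a set \<Rightarrow> (nat \<Rightarrow> 'a \<Rightarrow> real) set" where
  "covers A = {h. range h \<subseteq> P \<and> (\<forall>x\<in>A. 1 \<le> (\<Sum>i. ennreal (h i x)))}"

text \<open>The upper integral of the indicator of \<open>A\<close>: covers by countable sums from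
  \<open>P\<close> replace covers by open sets.\<close>

definition outer :: "'a set \<Rightarrow> ennreal" where
  "outer A = (INF h\<in>covers A. \<Sum>i. ennreal (L (h i)))"

lemma outer_mono: "A \<subseteq> B \<Longrightarrow> outer A \<le> outer B"
  unfolding outer_def by (rule INF_superset_mono) (auto simp: covers_def)

lemma sum_first:
  fixes c :: "'b \<Rightarrow> ennreal"
  assumes "c z = 0"
  shows "(\<Sum>i. c (if i = (0::nat) then f else z)) = c f"
proof -
  have "(\<Sum>i. c (if i = (0::nat) then f else z)) = (\<Sum>i\<in>{0::nat}. c (if i = (0::nat) then f else z))"
    by (rule suminf_finite) (auto simp: assms)
  then show ?thesis by simp
qed

lemma outer_le:
  assumes "f \<in> P" "\<And>x. x \<in> A \<Longrightarrow> 1 \<le> f x"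
  shows "outer A \<le> ennreal (L f)"
proof -
  define h where "h i = (if i = (0::nat) then f else (\<lambda>_. 0))" for i
  have "(\<Sum>i. ennreal (h i x)) = ennreal (f x)" for x
    unfolding h_def by (rule sum_first[where c = "\<lambda>f. ennreal (f x)"]) simp
  then have "h \<in> covers A"
    using assms zero by (auto simp: covers_def h_def)
  moreover have "(\<Sum>i. ennreal (L (h i))) = ennreal (L f)"
    unfolding h_def by (rule sum_first[where c = "\<lambda>f. ennreal (L f)"]) (simp add: L_zero)
  ultimately show ?thesis
    unfolding outer_def by (metis INF_lower)
qed

text \<open>Every cover of \<open>A\<close> dominates \<open>f\<close>, which is at most 1 on
  \<open>A\<close> and at most 0 elsewhere. The Daniell condition enters through
  \<open>L_le_suminf\<close> and prevents \<open>outer\<close> from being too small to represent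
  \<open>L\<close>.\<close>

lemma le_outer:
  assumes "f \<in> P" "\<And>x. f x \<le> indicator A x"
  shows "ennreal (L f) \<le> outer A"
  unfolding outer_def
proof (rule INF_greatest)
  fix h assume h: "h \<in> covers A"
  show "ennreal (L f) \<le> (\<Sum>i. ennreal (L (h i)))"
  proof (rule L_le_suminf[OF assms(1)])
    show "h i \<in> P" for i using h by (auto simp: covers_def)
    show "ennreal (f x) \<le> (\<Sum>i. ennreal (h i x))" for x
    proof (cases "x \<in> A")
      case True
      then have "ennreal (f x) \<le> 1"
        using assms(2)[of x] by (simp add: ennreal_leI flip: ennreal_1)
      also have "1 \<le> (\<Sum>i. ennreal (h i x))"
        using True h by (auto simp: covers_def)
      finally show ?thesis .
    qed (use assms(2)[of x] in \<open>simp add: ennreal_neg\<close>)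
  qed
qed

lemma outer_approx:
  assumes "outer A < top" "0 < \<epsilon>"
  obtains h where "h \<in> covers A" "(\<Sum>i. ennreal (L (h i))) \<le> outer A + ennreal \<epsilon>"
proof -
  have "outer A < outer A + ennreal \<epsilon>"
    using assms by (simp add: ennreal_add_left_cancel_less)
  then show ?thesis
    using that unfolding outer_def by (auto simp: INF_less_iff less_imp_le)
qed

text \<open>Near-optimal covers of the \<open>A i\<close>, with errors
  \<open>\<epsilon> * (1/2) ^ Suc i\<close> summing to \<open>\<epsilon>\<close>, are merged into a
  single cover along \<open>prod_decode\<close>.\<close>

lemma outer_UN_le: "outer (\<Union>i. A i) \<le> (\<Sum>i. outer (A i))"
proof (cases "\<forall>i. outer (A i) < top")
  case False
  then obtain i where "outer (A i) = top"
    using top.not_eq_extremum by blast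
  then have "(\<Sum>i. outer (A i)) = top"
    using ennreal_suminf_lessD[of "\<lambda>i. outer (A i)" top i] top.not_eq_extremum by force
  then show ?thesis by simp
next
  case True
  show ?thesis
  proof (rule ennreal_le_epsilon)
    fix \<epsilon> :: real assume "0 < \<epsilon>"
    have "\<exists>h\<in>covers (A i). (\<Sum>j. ennreal (L (h j))) \<le> outer (A i) + ennreal (\<epsilon> * (1/2) ^ Suc i)" for i
      using outer_approx[of "A i" "\<epsilon> * (1/2) ^ Suc i"] True \<open>0 < \<epsilon>\<close>
      by (metis half_gt_zero_iff mult_pos_pos zero_less_one zero_less_power)
    then obtain h where h: "\<And>i. h i \<in> covers (A i)"
      and le: "\<And>i. (\<Sum>j. ennreal (L (h i j))) \<le> outer (A i) + ennreal (\<epsilon> * (1/2) ^ Suc i)"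
      by metis
    define H where "H k = (case prod_decode k of (i, j) \<Rightarrow> h i j)" for k
    have H: "(\<Sum>k. c (H k)) = (\<Sum>i. \<Sum>j. c (h i j))" for c :: "('a \<Rightarrow> real) \<Rightarrow> ennreal"
      using suminf_ennreal_2dimen[of "\<lambda>i. \<Sum>j. c (h i j)" "\<lambda>(i, j). c (h i j)"]
      by (simp add: H_def case_prod_unfold comp_def)
    have "H \<in> covers (\<Union>i. A i)"
    proof -
      have "1 \<le> (\<Sum>k. ennreal (H k x))" if "x \<in> A i" for x i
      proof -
        have "1 \<le> (\<Sum>j. ennreal (h i j x))"
          using h that by (auto simp: covers_def)
        also have "\<dots> = (\<Sum>i\<in>{i}. \<Sum>j. ennreal (h i j x))" by simp
        also have "\<dots> \<le> (\<Sum>i. \<Sum>j. ennreal (h i j x))"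
          by (rule sum_le_suminf) auto
        also have "\<dots> = (\<Sum>k. ennreal (H k x))"
          by (rule H[where c = "\<lambda>f. ennreal (f x)", symmetric])
        finally show ?thesis .
      qed
      moreover have "h i j \<in> P" for i j
        using h[of i] by (auto simp: covers_def)
      ultimately show ?thesis
        by (auto simp: covers_def H_def split: prod.splits)
    qed
    then have "outer (\<Union>i. A i) \<le> (\<Sum>k. ennreal (L (H k)))"
      unfolding outer_def by (rule INF_lower)
    also have "\<dots> = (\<Sum>i. \<Sum>j. ennreal (L (h i j)))"
      by (rule H)
    also have "\<dots> \<le> (\<Sum>i. outer (A i) + ennreal (\<epsilon> * (1/2) ^ Suc i))"
      by (intro suminf_le le) auto
    also have "\<dots> = (\<Sum>i. outer (A i)) + (\<Sum>i. ennreal (\<epsilon> * (1/2) ^ Suc i))"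
      by (intro suminf_add[symmetric]) auto
    also have "(\<Sum>i. ennreal (\<epsilon> * (1/2) ^ Suc i)) = ennreal \<epsilon>"
      using \<open>0 < \<epsilon>\<close> by (intro suminf_halves) auto
    finally show "outer (\<Union>i. A i) \<le> (\<Sum>i. outer (A i)) + ennreal \<epsilon>" .
  qed
qed

lemma outer_empty: "outer {} = 0"
  using outer_le[OF zero, of "{}"] by (simp add: L_zero)

lemma outer_measure_space_outer: "outer_measure_space UNIV outer"
  by (auto simp: outer_measure_space_def positive_def outer_empty increasing_def outer_mono
      countably_subadditive_def outer_UN_le)

lemma outer_Un_le: "outer (A \<union> B) \<le> outer A + outer B"
proof -
  have "(\<Union>i. (if i = (0::nat) then A else if i = 1 then B else {})) = A \<union> B"
    by (auto split: if_splits)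
  moreover have "(\<Sum>i. outer (if i = (0::nat) then A else if i = 1 then B else {})) = outer A + outer B"
    by (subst suminf_finite[of "{0,1}"]) (auto simp: outer_empty)
  ultimately show ?thesis
    using outer_UN_le[of "\<lambda>i. if i = (0::nat) then A else if i = 1 then B else {}"] by simp
qed

text \<open>A cover \<open>h\<close> of \<open>A\<close> is split along \<open>{g > 0}\<close> by means of \<open>min (h i) (n * g)\<close>, which
  increases to \<open>h i\<close> on \<open>{g > 0}\<close> and vanishes elsewhere.\<close>

lemma outer_split:
  assumes g: "g \<in> P"
  shows "outer (A \<inter> {x. g x > 0}) + outer (A - {x. g x > 0}) \<le> outer A"
proof (cases "outer A < top")
  case False
  then have "outer A = top"
    using top.not_eq_extremum by blast
  then show ?thesis by simp
next
  case True
  show ?thesis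
  proof (rule ennreal_le_epsilon)
    fix \<epsilon> :: real assume "0 < \<epsilon>"
    \<comment> \<open>One half of \<open>\<epsilon>\<close> pays for the choice of the cover, the
      other for stopping each truncation at a finite stage.\<close>
    obtain h where h: "h \<in> covers A" and hle: "(\<Sum>i. ennreal (L (h i))) \<le> outer A + ennreal (\<epsilon>/2)"
      using outer_approx[OF True, of "\<epsilon>/2"] \<open>0 < \<epsilon>\<close> by auto
    have hP: "h i \<in> P" for i using h by (auto simp: covers_def)
    define u where "u i n = (\<lambda>x. min (h i x) (real n * g x))" for i n
    define v where "v i n = (\<lambda>x. u i (Suc n) x - u i n x)" for i n
    have uP: "u i n \<in> P" for i n
      unfolding u_def by (intro minimum hP scale g)
    have u_le: "u i n x \<le> h i x" for i n x
      by (simp add: u_def)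
    have u_Suc: "u i n x \<le> u i (Suc n) x" for i n x
      using nonneg[OF g, of x] by (auto simp: u_def algebra_simps intro!: min.mono)
    have u_mono: "L (u i n) \<le> L (u i m)" if "n \<le> m" for i n m
      using lift_Suc_mono_le[of "\<lambda>n. L (u i n)" n m] that L_mono[OF uP uP u_Suc] by blast
    have vP: "v i n \<in> P" for i n
      unfolding v_def by (intro diff uP u_Suc)
    have u0: "u i 0 = (\<lambda>_. 0)" for i
      using nonneg[OF hP] by (auto simp: u_def fun_eq_iff)
    have Lv: "(\<Sum>n<N. L (v i n)) = L (u i N)" for i N
      by (induction N) (auto simp: u0 L_zero v_def L_diff uP u_Suc)
    have v_sum: "(\<Sum>n<N. v i n x) = u i N x" for i N x
      by (induction N) (auto simp: u0 v_def)
    \<comment> \<open>The increments \<open>v i n\<close> telescope to \<open>u i N\<close>, so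
      \<open>s i\<close> is the total of \<open>L\<close> over them. Summed over \<open>n\<close>,
      they recover \<open>h i\<close> where \<open>g\<close> is positive and thus cover the first
      part of \<open>A\<close>.\<close>
    define s where "s i = (SUP N. L (u i N))" for i
    have bdd_u: "bdd_above (range (\<lambda>N. L (u i N)))" for i
      by (rule bdd_aboveI2[of _ _ "L (h i)"]) (simp add: L_mono uP hP u_le)
    have "(\<lambda>N. L (u i N)) \<longlonglongrightarrow> s i" for i
      unfolding s_def by (rule LIMSEQ_incseq_SUP[OF bdd_u]) (simp add: incseq_def u_mono)
    then have Lv_sums: "(\<lambda>n. L (v i n)) sums s i" for i
      by (simp add: sums_def Lv)
    have "\<exists>n. s i < L (u i n) + \<epsilon>/2 * (1/2) ^ Suc i" for i
    proof -
      have "s i - \<epsilon>/2 * (1/2) ^ Suc i < s i" using \<open>0 < \<epsilon>\<close> by simp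
      then have "\<exists>n. s i - \<epsilon>/2 * (1/2) ^ Suc i < L (u i n)"
        unfolding s_def using less_cSUP_iff[OF _ bdd_u] by blast
      then show ?thesis
        by (simp only: diff_less_eq)
    qed
    then obtain n where n: "\<And>i. s i < L (u i (n i)) + \<epsilon>/2 * (1/2) ^ Suc i" by metis
    \<comment> \<open>The finite stage \<open>n i\<close> already carries almost all of
      \<open>s i\<close>, so \<open>s i + L (w i)\<close> exceeds \<open>L (h i)\<close> only by the
      chosen error. Where \<open>g\<close> vanishes, \<open>w i\<close> is \<open>h i\<close>; hence
      \<open>w\<close> covers the second part of \<open>A\<close>.\<close>
    define w where "w i = (\<lambda>x. h i x - u i (n i) x)" for i
    have wP: "w i \<in> P" for i
      unfolding w_def by (intro diff hP uP u_le)
    have Lw: "L (w i) = L (h i) - L (u i (n i))" for i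
      unfolding w_def by (intro L_diff hP uP u_le)
    define H where "H k = (case prod_decode k of (i, j) \<Rightarrow> v i j)" for k
    have H: "(\<Sum>k. c (H k)) = (\<Sum>i. \<Sum>j. c (v i j))" for c :: "('a \<Rightarrow> real) \<Rightarrow> ennreal"
      using suminf_ennreal_2dimen[of "\<lambda>i. \<Sum>j. c (v i j)" "\<lambda>(i, j). c (v i j)"]
      by (simp add: H_def case_prod_unfold comp_def)
    have "H \<in> covers (A \<inter> {x. g x > 0})"
    proof -
      have "1 \<le> (\<Sum>k. ennreal (H k x))" if "x \<in> A" "g x > 0" for x
      proof -
        have "(\<Sum>j. ennreal (v i j x)) = ennreal (h i x)" for i
        proof (rule suminf_ennreal_eq)
          show "0 \<le> v i j x" for j by (rule nonneg[OF vP])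
          obtain N where N: "h i x < real N * g x"
            using reals_Archimedean3[OF \<open>g x > 0\<close>] by blast
          have "u i m x = h i x" if "m \<ge> N" for m
          proof -
            have "real N * g x \<le> real m * g x"
              using that \<open>g x > 0\<close> by simp
            then show ?thesis using N by (simp add: u_def)
          qed
          then show "(\<lambda>j. v i j x) sums h i x"
            unfolding sums_def v_sum
            by (intro tendsto_eventually) (auto simp: eventually_sequentially)
        qed
        then have "(\<Sum>k. ennreal (H k x)) = (\<Sum>i. ennreal (h i x))"
          using H[of "\<lambda>f. ennreal (f x)"] by simp
        then show ?thesis using h that by (auto simp: covers_def)
      qed
      then show ?thesis
        using vP by (auto simp: covers_def H_def split: prod.splits)
    qed
    then have "outer (A \<inter> {x. g x > 0}) \<le> (\<Sum>k. ennreal (L (H k)))"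
      unfolding outer_def by (rule INF_lower)
    also have "\<dots> = (\<Sum>i. \<Sum>j. ennreal (L (v i j)))"
      by (rule H)
    also have "\<dots> = (\<Sum>i. ennreal (s i))"
      by (intro suminf_cong suminf_ennreal_eq Lv_sums L_nonneg vP)
    finally have 1: "outer (A \<inter> {x. g x > 0}) \<le> (\<Sum>i. ennreal (s i))" .
    have "w \<in> covers (A - {x. g x > 0})"
    proof -
      have "w i x = h i x" if "\<not> g x > 0" for i x
        using that nonneg[OF g, of x] nonneg[OF hP, of i x] by (auto simp: w_def u_def)
      then show ?thesis using h wP by (auto simp: covers_def)
    qed
    then have 2: "outer (A - {x. g x > 0}) \<le> (\<Sum>i. ennreal (L (w i)))"
      unfolding outer_def by (rule INF_lower)
    have s0: "0 \<le> s i" for i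
      using sums_le[OF _ sums_zero Lv_sums] L_nonneg[OF vP] by auto
    have "outer (A \<inter> {x. g x > 0}) + outer (A - {x. g x > 0})
        \<le> (\<Sum>i. ennreal (s i)) + (\<Sum>i. ennreal (L (w i)))"
      by (intro add_mono 1 2)
    also have "\<dots> = (\<Sum>i. ennreal (s i + L (w i)))"
      by (subst suminf_add) (auto simp: s0 L_nonneg wP ennreal_plus)
    also have "\<dots> \<le> (\<Sum>i. ennreal (L (h i)) + ennreal (\<epsilon>/2 * (1/2) ^ Suc i))"
    proof (intro suminf_le)
      fix i
      have "s i + L (w i) \<le> L (h i) + \<epsilon>/2 * (1/2) ^ Suc i"
        using n[of i] by (simp add: Lw)
      then show "ennreal (s i + L (w i)) \<le> ennreal (L (h i)) + ennreal (\<epsilon>/2 * (1/2) ^ Suc i)"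
        using L_nonneg[OF hP, of i] \<open>0 < \<epsilon>\<close>
        by (subst ennreal_plus[symmetric]) (auto simp del: ennreal_plus intro: ennreal_leI)
    qed auto
    also have "\<dots> = (\<Sum>i. ennreal (L (h i))) + (\<Sum>i. ennreal (\<epsilon>/2 * (1/2) ^ Suc i))"
      by (intro suminf_add[symmetric]) auto
    also have "(\<Sum>i. ennreal (\<epsilon>/2 * (1/2) ^ Suc i)) = ennreal (\<epsilon>/2)"
      using \<open>0 < \<epsilon>\<close> by (intro suminf_halves) auto
    also have "(\<Sum>i. ennreal (L (h i))) + ennreal (\<epsilon>/2) \<le> outer A + ennreal (\<epsilon>/2) + ennreal (\<epsilon>/2)"
      by (intro add_mono hle order_refl)
    also have "\<dots> = outer A + ennreal \<epsilon>"
      using \<open>0 < \<epsilon>\<close> ennreal_plus[of "\<epsilon>/2" "\<epsilon>/2"] by (simp add: add.assoc del: ennreal_plus)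
    finally show "outer (A \<inter> {x. g x > 0}) + outer (A - {x. g x > 0}) \<le> outer A + ennreal \<epsilon>" .
  qed
qed

text \<open>Caratheodory: \<open>outer_split\<close> and subadditivity put each
  \<open>{x. g x > 0}\<close> into the lambda system. Open sets are countable unions of these, so
  the lambda system contains the Borel sets.\<close>

lemma measure_space_outer: "measure_space UNIV (sets borel) outer"
proof -
  interpret U: sigma_algebra UNIV "UNIV :: 'a set set"
    using sigma_algebra_Pow[of UNIV] by simp
  define \<Lambda> where "\<Lambda> = lambda_system UNIV UNIV outer"
  have ms: "measure_space UNIV \<Lambda> outer"
    unfolding \<Lambda>_def by (rule U.caratheodory_lemma[OF outer_measure_space_outer])
  interpret \<Lambda>: sigma_algebra UNIV \<Lambda>
    using ms by (simp add: measure_space_def)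
  have pos: "{x. g x > 0} \<in> \<Lambda>" if "g \<in> P" for g
  proof -
    have "outer (A \<inter> {x. g x > 0}) + outer (A - {x. g x > 0}) = outer A" for A
      using outer_split[OF that, of A] outer_Un_le[of "A \<inter> {x. g x > 0}" "A - {x. g x > 0}"]
      by (simp add: Int_Diff_Un order_antisym)
    then show ?thesis
      by (simp add: \<Lambda>_def U.lambda_system_eq)
  qed
  have "W \<in> \<Lambda>" if "open W" for W
  proof -
    have "W = (\<Union>g\<in>{g\<in>P. {x. g x > 0} \<subseteq> W}. {x. g x > 0})"
      using base[OF that] by blast
    also have "\<dots> \<in> \<Lambda>"
      using countable_P pos by (intro \<Lambda>.countable_UN'') (auto intro: countable_subset)
    finally show ?thesis .
  qed
  then have sub: "sets borel \<subseteq> \<Lambda>"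
    using \<Lambda>.sigma_sets_subset[of "Collect open"] by (auto simp: borel_def)
  have ca: "countably_additive \<Lambda> outer"
    using ms by (simp add: measure_space_def)
  have "countably_additive (sets borel) outer"
    unfolding countably_additive_def
  proof (intro allI impI)
    fix A :: "nat \<Rightarrow> 'a set"
    assume A: "range A \<subseteq> sets borel" "disjoint_family A" "(\<Union>i. A i) \<in> sets borel"
    then show "(\<Sum>i. outer (A i)) = outer (\<Union>i. A i)"
      using ca sub unfolding countably_additive_def by (meson order_trans subsetD)
  qed
  moreover have "sigma_algebra UNIV (sets borel :: 'a set set)"
    by (metis sets.sigma_algebra_axioms space_borel)
  ultimately show ?thesis
    by (simp add: measure_space_def positive_def outer_empty)
qed

section \<open>The representing measure and its integrals\<close>

definition representing_measure :: "'a measure" where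
  "representing_measure = measure_of UNIV (sets borel) outer"

lemma sets_representing_measure [simp, measurable_cong]:
  "sets representing_measure = sets borel"
  using sets.sigma_sets_eq[of "borel :: 'a measure"] by (simp add: representing_measure_def)

lemma emeasure_representing_measure:
  "A \<in> sets borel \<Longrightarrow> emeasure representing_measure A = outer A"
  unfolding representing_measure_def using measure_space_outer
  by (intro emeasure_measure_of_sigma)
     (auto simp: measure_space_def)

lemma borel_measurable_P [measurable]: "f \<in> P \<Longrightarrow> f \<in> borel_measurable borel"
  by (intro borel_measurable_continuous_onI cont)

lemma additive_sum:
  fixes \<Phi> :: "('a \<Rightarrow> real) \<Rightarrow> ennreal"
  assumes "\<And>g h. g \<in> P \<Longrightarrow> h \<in> P \<Longrightarrow> \<Phi> (\<lambda>x. g x + h x) = \<Phi> g + \<Phi> h" "\<Phi> (\<lambda>_. 0) = 0"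
    and "\<And>i. h i \<in> P"
  shows "\<Phi> (\<lambda>x. \<Sum>i<(n::nat). h i x) = (\<Sum>i<n. \<Phi> (h i))"
  using assms by (induction n) (auto simp: sum_closed)

text \<open>Both \<open>L\<close> and the integral lie between the same layer-cake sums of \<open>outer {g > k}\<close>.\<close>

lemma layer_comparison:
  fixes \<Phi> \<Psi> :: "('a \<Rightarrow> real) \<Rightarrow> ennreal"
  assumes \<Phi>_add: "\<And>g h. g \<in> P \<Longrightarrow> h \<in> P \<Longrightarrow> \<Phi> (\<lambda>x. g x + h x) = \<Phi> g + \<Phi> h"
    and \<Psi>_add: "\<And>g h. g \<in> P \<Longrightarrow> h \<in> P \<Longrightarrow> \<Psi> (\<lambda>x. g x + h x) = \<Psi> g + \<Psi> h"
    and \<Psi>_zero: "\<Psi> (\<lambda>_. 0) = 0"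
    and \<Phi>_le: "\<And>g A. g \<in> P \<Longrightarrow> A \<in> sets borel \<Longrightarrow> (\<And>x. g x \<le> indicator A x) \<Longrightarrow> \<Phi> g \<le> outer A"
    and \<Psi>_ge: "\<And>g A. g \<in> P \<Longrightarrow> A \<in> sets borel \<Longrightarrow> (\<And>x. x \<in> A \<Longrightarrow> 1 \<le> g x) \<Longrightarrow> outer A \<le> \<Psi> g"
    and g: "g \<in> P"
  shows "\<Phi> (\<lambda>x. g x - min (g x) 1) \<le> \<Psi> g"
proof -
  \<comment> \<open>The slab of \<open>g\<close> between the heights \<open>k\<close> and
    \<open>k + 1\<close>. It lies between the indicators of \<open>{g > k + 1}\<close> and
    \<open>{g > k}\<close>.\<close>
  define d where "d k = (\<lambda>x. min (g x) (real (Suc k)) - min (g x) (real k))" for k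
  have d: "d k \<in> P" for k
    unfolding d_def by (intro diff trunc g) auto
  define A where "A k = {x. g x > real k}" for k
  have A: "A k \<in> sets borel" for k
    using borel_measurable_P[OF g] unfolding A_def by measurable
  have \<Phi>_zero: "\<Phi> (\<lambda>_. 0) = 0"
    using \<Phi>_le[OF zero, of "{}"] by (simp add: outer_empty)
  obtain C where C: "\<And>x. g x \<le> C" using bdd[OF g] by blast
  obtain K :: nat where "C \<le> real K" using real_arch_simple by blast
  then have K: "g x \<le> real K" for x using C[of x] by linarith
  have sum: "(\<Sum>k<n. d k x) = min (g x) (real n)" for n x
    using nonneg[OF g, of x] by (induction n) (auto simp: d_def)
  have sum': "(\<Sum>k<n. d (Suc k) x) = min (g x) (real (Suc n)) - min (g x) 1" for n x
    by (induction n) (auto simp: d_def)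
  \<comment> \<open>Removing the bottom slab shifts the index by one: slab \<open>k + 1\<close> lies
    below the indicator of \<open>A (Suc k)\<close>, which lies below slab \<open>k\<close>. Hence
    the left side is compared with all of \<open>g\<close>.\<close>
  have "(\<lambda>x. g x - min (g x) 1) = (\<lambda>x. \<Sum>k<K. d (Suc k) x)"
  proof
    show "g x - min (g x) 1 = (\<Sum>k<K. d (Suc k) x)" for x
      using K[of x] by (simp add: sum' min_absorb1)
  qed
  then have "\<Phi> (\<lambda>x. g x - min (g x) 1) = (\<Sum>k<K. \<Phi> (d (Suc k)))"
    using additive_sum[of \<Phi> "\<lambda>k. d (Suc k)" K] \<Phi>_add \<Phi>_zero d by simp
  also have "\<dots> \<le> (\<Sum>k<K. outer (A (Suc k)))"
    by (intro sum_mono \<Phi>_le d A) (auto simp: d_def A_def indicator_def)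
  also have "\<dots> \<le> (\<Sum>k<K. \<Psi> (d k))"
    by (intro sum_mono \<Psi>_ge d A) (auto simp: d_def A_def)
  also have "\<dots> = \<Psi> (\<lambda>x. \<Sum>k<K. d k x)"
    using additive_sum[of \<Psi> d K] \<Psi>_add \<Psi>_zero d by simp
  also have "(\<lambda>x. \<Sum>k<K. d k x) = g"
    using K by (simp add: sum fun_eq_iff)
  finally show ?thesis .
qed

text \<open>The layer comparison is applied to \<open>(n + 1) * f\<close> in both directions. After
  division by \<open>n + 1\<close>, the lost bottom slab is \<open>m n\<close>, at most
  \<open>1 / (n + 1)\<close>; its contribution vanishes by monotone convergence for the integral and
  by the Daniell condition for \<open>L\<close>.\<close>

theorem nn_integral_representing_measure:
  assumes f: "f \<in> P"
  shows "(\<integral>\<^sup>+x. ennreal (f x) \<partial>representing_measure) = ennreal (L f)"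
proof -
  let ?I = "\<lambda>g. \<integral>\<^sup>+x. ennreal (g x) \<partial>representing_measure"
  let ?L = "\<lambda>g. ennreal (L g)"
  have meas [measurable]: "g \<in> borel_measurable representing_measure" if "g \<in> P" for g
    using borel_measurable_P[OF that] by simp
  have I_add: "?I (\<lambda>x. g x + h x) = ?I g + ?I h" if "g \<in> P" "h \<in> P" for g h
    using that nonneg by (subst nn_integral_add[symmetric]) (auto simp: ennreal_plus)
  have L_add': "?L (\<lambda>x. g x + h x) = ?L g + ?L h" if "g \<in> P" "h \<in> P" for g h
    using that L_nonneg by (auto simp: L_add ennreal_plus)
  have I_le: "?I g \<le> outer A" if "g \<in> P" "A \<in> sets borel" "\<And>x. g x \<le> indicator A x" for g A
  proof -
    have "?I g \<le> (\<integral>\<^sup>+x. indicator A x \<partial>representing_measure)"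
      using that(3) by (intro nn_integral_mono) (metis ennreal_indicator ennreal_leI)
    then show ?thesis using that(2) by (simp add: emeasure_representing_measure)
  qed
  have I_ge: "outer A \<le> ?I g" if "g \<in> P" "A \<in> sets borel" "\<And>x. x \<in> A \<Longrightarrow> 1 \<le> g x" for g A
  proof -
    have "(\<integral>\<^sup>+x. indicator A x \<partial>representing_measure) \<le> ?I g"
      using that(3) by (intro nn_integral_mono) (auto simp: indicator_def ennreal_leI simp flip: ennreal_1)
    then show ?thesis using that(2) by (simp add: emeasure_representing_measure)
  qed
  define m where "m n = (\<lambda>x. min (f x) (1 / real (Suc n)))" for n
  have mP: "m n \<in> P" for n
    unfolding m_def by (intro trunc f) auto
  have m_le: "m n x \<le> f x" for n x by (simp add: m_def)
  have dP: "(\<lambda>x. f x - m n x) \<in> P" for n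
    by (intro diff f mP m_le)
  have m_dec: "decseq (\<lambda>n. m n x)" for x
    unfolding m_def by (intro decseq_SucI min.mono order_refl divide_left_mono) auto
  have m_lim: "(\<lambda>n. m n x) \<longlonglongrightarrow> 0" for x
  proof (rule tendsto_sandwich[OF _ _ tendsto_const])
    show "(\<lambda>n. 1 / real (Suc n)) \<longlonglongrightarrow> 0"
      using LIMSEQ_inverse_real_of_nat by (simp add: inverse_eq_divide)
  qed (use nonneg[OF f] in \<open>auto simp: m_def\<close>)
  have scaled: "real (Suc n) * f x - min (real (Suc n) * f x) 1 = real (Suc n) * (f x - m n x)" for n x
    by (auto simp: m_def min_def field_simps)
  have I_scale: "?I (\<lambda>x. real n * g x) = of_nat n * ?I g" if "g \<in> P" for g n
    using that nonneg
    by (subst nn_integral_cmult[symmetric]) (auto simp: ennreal_mult ennreal_of_nat_eq_real_of_nat)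
  have L_scale': "?L (\<lambda>x. real n * g x) = of_nat n * ?L g" if "g \<in> P" for g n
    using that L_nonneg by (simp add: L_scale ennreal_mult ennreal_of_nat_eq_real_of_nat)
  have cancel: "a \<le> b" if "of_nat (Suc n) * a \<le> of_nat (Suc n) * b" for n and a b :: ennreal
    using that ennreal_mult_le_mult_iff[of "of_nat (Suc n)" a b] by (simp del: of_nat_Suc)
  have IL: "?I (\<lambda>x. f x - m n x) \<le> ?L f" for n
  proof (rule cancel)
    have "?I (\<lambda>x. real (Suc n) * f x - min (real (Suc n) * f x) 1) \<le> ?L (\<lambda>x. real (Suc n) * f x)"
      by (rule layer_comparison[where \<Phi> = ?I and \<Psi> = ?L])
         (auto simp: I_add L_add' L_zero I_le outer_le simp del: of_nat_Suc intro: scale f)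
    then show "of_nat (Suc n) * ?I (\<lambda>x. f x - m n x) \<le> of_nat (Suc n) * ?L f"
      unfolding scaled I_scale[OF dP] L_scale'[OF f] .
  qed
  have LI: "?L (\<lambda>x. f x - m n x) \<le> ?I f" for n
  proof (rule cancel)
    have "?L (\<lambda>x. real (Suc n) * f x - min (real (Suc n) * f x) 1) \<le> ?I (\<lambda>x. real (Suc n) * f x)"
      by (rule layer_comparison[where \<Phi> = ?L and \<Psi> = ?I])
         (auto simp: I_add L_add' L_zero I_ge le_outer simp del: of_nat_Suc intro: scale f)
    then show "of_nat (Suc n) * ?L (\<lambda>x. f x - m n x) \<le> of_nat (Suc n) * ?I f"
      unfolding scaled L_scale'[OF dP] I_scale[OF f] .
  qed
  have "(\<lambda>n. ?I (\<lambda>x. f x - m n x)) \<longlonglongrightarrow> ?I f"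
  proof (rule nn_integral_LIMSEQ)
    show "incseq (\<lambda>n x. ennreal (f x - m n x))"
      using m_dec by (auto simp: incseq_def decseq_def le_fun_def intro!: ennreal_leI)
    show "(\<lambda>n. ennreal (f x - m n x)) \<longlonglongrightarrow> ennreal (f x)" for x
      using tendsto_diff[OF tendsto_const m_lim, of "f x" x] by (intro tendsto_ennrealI) simp
  qed (use dP in measurable)
  then have "?I f \<le> ?L f"
    using IL by (intro LIMSEQ_le_const2) auto
  moreover have "(\<lambda>n. ?L (\<lambda>x. f x - m n x)) \<longlonglongrightarrow> ?L f"
  proof (rule tendsto_ennrealI)
    have "(\<lambda>n. L f - L (m n)) \<longlonglongrightarrow> L f - 0"
      by (intro tendsto_intros L_daniell mP m_dec m_lim)
    then show "(\<lambda>n. L (\<lambda>x. f x - m n x)) \<longlonglongrightarrow> L f"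
      by (simp add: L_diff[OF f mP m_le])
  qed
  then have "?L f \<le> ?I f"
    using LI by (intro LIMSEQ_le_const2) auto
  ultimately show ?thesis by simp
qed

corollary integral_representing_measure:
  assumes "f \<in> P"
  shows "(\<integral>x. f x \<partial>representing_measure) = L f"
  using nn_integral_representing_measure[OF assms] nonneg[OF assms] L_nonneg[OF assms]
    borel_measurable_P[OF assms]
  by (subst integral_eq_nn_integral) auto

end

section \<open>Test functions and bounded sets\<close>

lemma borel_measurable_if_sets_borel:
  "continuous_on UNIV f \<Longrightarrow> sets \<mu> = sets borel \<Longrightarrow> f \<in> borel_measurable \<mu>"
  using borel_measurable_continuous_onI measurable_cong_sets by blast

text \<open>In a complete space the closure of a totally bounded range is compact. Radius
  \<open>e/2\<close> leaves room for passing to the closure, which is covered by closed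
  balls.\<close>

lemma convergent_subseq_if_totally_bounded:
  fixes x :: "nat \<Rightarrow> 'a::complete_space"
  assumes "\<And>e. 0 < e \<Longrightarrow> \<exists>K. finite K \<and> (\<forall>i. \<exists>y\<in>K. dist (x i) y < e)"
  obtains l r where "strict_mono (r :: nat \<Rightarrow> nat)" "(x \<circ> r) \<longlonglongrightarrow> l"
proof -
  have "\<exists>K. finite K \<and> closure (range x) \<subseteq> (\<Union>y\<in>K. ball y e)" if "0 < e" for e
  proof -
    obtain K where K: "finite K" "\<And>i. \<exists>y\<in>K. dist (x i) y < e/2"
      using assms[of "e/2"] \<open>0 < e\<close> by auto
    have "closure (range x) \<subseteq> (\<Union>y\<in>K. cball y (e/2))"
    proof (rule closure_minimal)
      show "range x \<subseteq> (\<Union>y\<in>K. cball y (e/2))"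
      proof safe
        fix i
        show "x i \<in> (\<Union>y\<in>K. cball y (e/2))"
          using K(2)[of i] by (metis UN_iff dist_commute less_imp_le mem_cball)
      qed
    qed (use K(1) in auto)
    also have "\<dots> \<subseteq> (\<Union>y\<in>K. ball y e)"
      using \<open>0 < e\<close> by force
    finally show ?thesis using K(1) by blast
  qed
  then have "compact (closure (range x))"
    unfolding compact_eq_totally_bounded by (simp add: complete_eq_closed)
  then have "seq_compact (closure (range x))"
    by (rule compact_imp_seq_compact)
  moreover have "\<forall>i. x i \<in> closure (range x)"
    using closure_subset[of "range x"] by blast
  ultimately obtain l r where "strict_mono r" "(x \<circ> r) \<longlonglongrightarrow> l"
    unfolding seq_compact_def by blast
  then show ?thesis by (rule that)
qed

lemma CBb_plusD:
  assumes "f \<in> CBb_plus \<B>"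
  shows "0 \<le> f x" "continuous_on UNIV f" "closure {x. f x \<noteq> 0} \<in> \<B>"
    and "\<exists>C. \<forall>x. f x \<le> C"
proof -
  obtain C where "\<forall>x. norm (f x) \<le> C"
    using assms unfolding CBb_plus_def bounded_iff by blast
  then show "\<exists>C. \<forall>x. f x \<le> C"
    by (metis abs_ge_self order_trans real_norm_def)
qed (use assms in \<open>simp_all add: CBb_plus_def\<close>)

lemma boundedness_subset:
  "boundedness \<B> \<Longrightarrow> B \<in> \<B> \<Longrightarrow> A \<in> sets borel \<Longrightarrow> A \<subseteq> B \<Longrightarrow> A \<in> \<B>"
  unfolding boundedness_def by blast

lemma boundedness_Un:
  "boundedness \<B> \<Longrightarrow> A \<in> \<B> \<Longrightarrow> B \<in> \<B> \<Longrightarrow> A \<union> B \<in> \<B>"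
  unfolding boundedness_def by blast

lemma CBb_plusI:
  assumes "boundedness \<B>" "continuous_on UNIV f" "\<And>x. 0 \<le> f x" "\<And>x. f x \<le> C"
    and "B \<in> \<B>" "closure {x. f x \<noteq> 0} \<subseteq> B"
  shows "f \<in> CBb_plus \<B>"
proof -
  have "closure {x. f x \<noteq> 0} \<in> \<B>"
    by (rule boundedness_subset[OF assms(1,5) _ assms(6)]) simp
  moreover have "norm (f x) \<le> C" for x
    using assms(3,4)[of x] by simp
  then have "bounded (range f)"
    by (intro boundedI[of _ C]) auto
  ultimately show ?thesis
    using assms(2,3) by (simp add: CBb_plus_def)
qed

lemma CBb_plus_dominated:
  assumes "boundedness \<B>" "g \<in> CBb_plus \<B>" "continuous_on UNIV f"
    and f: "\<And>x. 0 \<le> f x" "\<And>x. f x \<le> c * g x"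
  shows "f \<in> CBb_plus \<B>"
proof -
  obtain C where C: "\<And>x. g x \<le> C" using CBb_plusD(4)[OF assms(2)] by blast
  have "f x \<le> \<bar>c\<bar> * C" for x
  proof -
    have "f x \<le> \<bar>c\<bar> * g x"
      using f(2)[of x] mult_right_mono[OF abs_ge_self CBb_plusD(1)[OF assms(2)], of c x] by linarith
    also have "\<dots> \<le> \<bar>c\<bar> * C" using C by (simp add: mult_left_mono)
    finally show ?thesis .
  qed
  moreover have "g x \<noteq> 0" if "f x \<noteq> 0" for x
    using f[of x] that by auto
  then have "closure {x. f x \<noteq> 0} \<subseteq> closure {x. g x \<noteq> 0}"
    by (intro closure_mono) auto
  ultimately show ?thesis
    by (intro CBb_plusI[OF assms(1,3) f(1) _ CBb_plusD(3)[OF assms(2)]])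
qed

lemma CBb_plus_add:
  assumes "boundedness \<B>" "f \<in> CBb_plus \<B>" "g \<in> CBb_plus \<B>"
  shows "(\<lambda>x. f x + g x) \<in> CBb_plus \<B>"
proof -
  obtain C D where "\<And>x. f x \<le> C" "\<And>x. g x \<le> D"
    using CBb_plusD(4)[OF assms(2)] CBb_plusD(4)[OF assms(3)] by blast
  moreover have "closure {x. f x + g x \<noteq> 0} \<subseteq> closure {x. f x \<noteq> 0} \<union> closure {x. g x \<noteq> 0}"
    unfolding closure_Un[symmetric] by (intro closure_mono) auto
  ultimately show ?thesis
    using assms
    by (intro CBb_plusI[where C = "C + D"
          and B = "closure {x. f x \<noteq> 0} \<union> closure {x. g x \<noteq> 0}"])
       (auto intro!: continuous_intros add_mono boundedness_Un add_nonneg_nonneg intro: CBb_plusD)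
qed

text \<open>A bounded function vanishing off a set of finite measure is integrable. Hence the
  default value 0 of the Bochner integral never interferes with \<open>\<mu>(f)\<close>.\<close>

lemma integrable_CBb_plus:
  assumes "f \<in> CBb_plus \<B>" "\<mu> \<in> locally_finite_measures \<B>"
  shows "integrable \<mu> f"
proof -
  obtain C where C: "\<And>x. f x \<le> C" using CBb_plusD(4)[OF assms(1)] by blast
  let ?A = "closure {x. f x \<noteq> 0}"
  have sets: "sets \<mu> = sets borel"
    using assms(2) by (simp add: locally_finite_measures_def)
  show ?thesis
  proof (rule integrableI_bounded_set[where A = ?A and B = C])
    show "f \<in> borel_measurable \<mu>"
      using CBb_plusD(2)[OF assms(1)] sets by (rule borel_measurable_if_sets_borel)
    show "emeasure \<mu> ?A < \<infinity>"
      using assms(2) CBb_plusD(3)[OF assms(1)] by (simp add: locally_finite_measures_def)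
    show "AE x in \<mu>. x \<notin> ?A \<longrightarrow> f x = 0"
      using closure_subset[of "{x. f x \<noteq> 0}"] by (intro AE_I2) blast
  qed (use C CBb_plusD(1)[OF assms(1)] sets in auto)
qed

lemma nn_integral_CBb_plus:
  assumes "f \<in> CBb_plus \<B>" "\<mu> \<in> locally_finite_measures \<B>"
  shows "(\<integral>\<^sup>+x. ennreal (f x) \<partial>\<mu>) = ennreal (\<integral>x. f x \<partial>\<mu>)"
  using assms by (intro nn_integral_eq_integral integrable_CBb_plus) (auto simp: CBb_plusD(1))

section \<open>Exhaustion by bounded open sets and cutoffs\<close>

lemma localizing_exhaustion:
  fixes \<B> :: "'a::topological_space set set"
  assumes "boundedness \<B>" "properly_localizes \<B>"
  obtains U :: "nat \<Rightarrow> 'a set"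
  where "\<And>n. open (U n)" "\<And>n. U n \<in> \<B>" "\<And>n. closure (U n) \<subseteq> U (Suc n)"
    "\<And>B. B \<in> \<B> \<Longrightarrow> \<exists>n. B \<subseteq> U n" "\<And>x. \<exists>n. x \<in> U n"
proof -
  obtain \<C> where C: "countable \<C>" "\<C> \<subseteq> \<B>" "\<And>B. B \<in> \<B> \<Longrightarrow> \<exists>C\<in>\<C>. B \<subseteq> C" "\<Union>\<C> = UNIV"
    using assms(2) by (auto simp: properly_localizes_def boundedness_basis_def)
  have proper: "\<exists>U\<in>\<B>. open U \<and> closure B \<subseteq> U" if "B \<in> \<B>" for B
    using assms(2) that by (auto simp: properly_localizes_def proper_boundedness_def)
  define c where "c = from_nat_into \<C>"
  have "\<C> \<noteq> {}" using C(4) by auto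
  then have range_c: "range c = \<C>"
    using C(1) by (simp add: c_def range_from_nat_into)
  then have c: "c n \<in> \<B>" for n
    using C(2) by blast
  \<comment> \<open>Properness is applied to the union of \<open>U n\<close> and the next basis set:
    absorbing the basis makes the chain cofinal, and containing \<open>closure (U n)\<close> leaves
    room for Urysohn functions.\<close>
  have "\<exists>U. \<forall>n. (open (U n) \<and> U n \<in> \<B> \<and> c n \<subseteq> U n) \<and> closure (U n) \<subseteq> U (Suc n)"
  proof (rule dependent_nat_choice)
    show "\<exists>V. open V \<and> V \<in> \<B> \<and> c 0 \<subseteq> V"
      using proper[OF c[of 0]] closure_subset by blast
    show "\<exists>W. (open W \<and> W \<in> \<B> \<and> c (Suc n) \<subseteq> W) \<and> closure V \<subseteq> W"
      if "open V \<and> V \<in> \<B> \<and> c n \<subseteq> V" for V n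
      using proper[OF boundedness_Un[OF assms(1), of V "c (Suc n)"]] that c
        closure_subset[of "V \<union> c (Suc n)"] closure_mono[of V "V \<union> c (Suc n)"] by blast
  qed
  then obtain U where U: "\<And>n. open (U n)" "\<And>n. U n \<in> \<B>" "\<And>n. c n \<subseteq> U n"
      "\<And>n. closure (U n) \<subseteq> U (Suc n)"
    by blast
  have "\<exists>n. B \<subseteq> U n" if "B \<in> \<B>" for B
    using C(3)[OF that] U(3) unfolding range_c[symmetric] by blast
  moreover have "\<exists>n. x \<in> U n" for x
  proof -
    have "x \<in> \<Union>(range c)" using C(4) by (simp add: range_c)
    then show ?thesis using U(3) by blast
  qed
  ultimately show ?thesis using that U(1,2,4) by blast
qed

lemma localizing_cutoff:
  fixes \<B> :: "'a::metric_space set set"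
  assumes "boundedness \<B>" "\<And>n. open (U n)" "\<And>n. U n \<in> \<B>" "\<And>n. closure (U n) \<subseteq> U (Suc n)"
  shows "\<exists>g\<in>CBb_plus \<B>. (\<forall>x. g x \<le> 1) \<and> (\<forall>x\<in>U n. g x = 1)"
proof -
  have disj: "disjnt (- U (Suc n)) (closure (U n))"
    using assms(4)[of n] by (auto simp: disjnt_def)
  obtain g :: "'a \<Rightarrow> real" where g: "continuous_map euclidean (top_of_set {0..1}) g"
      "g ` (- U (Suc n)) \<subseteq> {0}" "g ` closure (U n) \<subseteq> {1}"
    using Urysohn_lemma[OF metrizable_imp_normal_space[OF metrizable_space_euclidean] _ _ disj, of 0 1]
      assms(2) by (auto simp: closed_Compl)
  have cont: "continuous_on UNIV g" and range: "g x \<in> {0..1}" for x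
    using g(1) by (auto simp: continuous_map_in_subtopology)
  \<comment> \<open>The function vanishes off \<open>U (n + 1)\<close>, but its closed support is
    only known to lie in \<open>U (n + 2)\<close>, which is still bounded.\<close>
  have "{x. g x \<noteq> 0} \<subseteq> U (Suc n)"
    using g(2) by blast
  then have "closure {x. g x \<noteq> 0} \<subseteq> closure (U (Suc n))"
    by (rule closure_mono)
  also note assms(4)
  finally have "closure {x. g x \<noteq> 0} \<subseteq> U (Suc (Suc n))" .
  then have "g \<in> CBb_plus \<B>"
    using assms(1,3) cont range by (intro CBb_plusI[where C = 1]) auto
  moreover have "g x = 1" if "x \<in> U n" for x
    using g(3) that closure_subset by blast
  ultimately show ?thesis using range by auto
qed

section \<open>A countable determining family of test functions\<close>

text \<open>Syntax trees keep the generated family countable. In \<^verbatim>\<open>val\<close> below, a constant \<open>q\<close> is read as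
  \<open>\<bar>q\<bar>\<close>, so that every tree denotes a nonnegative function.\<close>

datatype test_expr = Cutoff nat | Tail nat nat nat | Hat nat nat nat
  | Sum test_expr test_expr | Monus test_expr test_expr | Trunc rat test_expr

instance test_expr :: countable
  by countable_datatype

locale localization =
  fixes \<B> :: "'a::polish_space set set" and U :: "nat \<Rightarrow> 'a set"
    and g :: "nat \<Rightarrow> 'a \<Rightarrow> real" and s :: "nat \<Rightarrow> 'a"
  assumes bnd: "boundedness \<B>"
    and U_open: "open (U n)" and U_in: "U n \<in> \<B>"
    and U_cofinal: "B \<in> \<B> \<Longrightarrow> \<exists>n. B \<subseteq> U n" and U_cover: "\<exists>n. x \<in> U n"
    and g_CB: "g n \<in> CBb_plus \<B>" and g_le: "g n x \<le> 1" and g_one: "x \<in> U n \<Longrightarrow> g n x = 1"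
    and s_dense: "open W \<Longrightarrow> W \<noteq> {} \<Longrightarrow> \<exists>i. s i \<in> W"
begin

abbreviation "M \<equiv> locally_finite_measures \<B>"

text \<open>Measures the failure of \<open>s 0, ..., s k\<close> to approximate the region seen by
  \<open>g n\<close> at scale \<open>1 / j\<close>; it decreases to 0 pointwise as \<open>k\<close>
  grows.\<close>

definition w :: "nat \<Rightarrow> nat \<Rightarrow> nat \<Rightarrow> 'a \<Rightarrow> real" where
  "w n j k x = min (g n x) (real j * infdist x (s ` {..k}))"

text \<open>For positive \<open>r\<close>, it equals \<open>g n\<close> within distance
  \<open>1 / r\<close> of \<open>s i\<close>, since \<open>g n\<close> is at most 1, and vanishes
  from distance \<open>2 / r\<close> on.\<close>

definition hat :: "nat \<Rightarrow> nat \<Rightarrow> nat \<Rightarrow> 'a \<Rightarrow> real" where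
  "hat n i r x = min (g n x) (max 0 (2 - real r * dist x (s i)))"

primrec val :: "test_expr \<Rightarrow> 'a \<Rightarrow> real" where
  "val (Cutoff n) = g n"
| "val (Tail n j k) = w n j k"
| "val (Hat n i r) = hat n i r"
| "val (Sum a b) = (\<lambda>x. val a x + val b x)"
| "val (Monus a b) = (\<lambda>x. max 0 (val a x - val b x))"
| "val (Trunc q a) = (\<lambda>x. min (val a x) (of_rat \<bar>q\<bar>))"

abbreviation "P \<equiv> range val"

lemma P_base: "g n \<in> P" "w n j k \<in> P" "hat n i r \<in> P"
  by (metis rangeI val.simps(1)) (metis rangeI val.simps(2), metis rangeI val.simps(3))

lemma g_nonneg: "0 \<le> g n x"
  by (rule CBb_plusD(1)[OF g_CB])

lemma g_cont: "continuous_on UNIV (g n)"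
  by (rule CBb_plusD(2)[OF g_CB])

lemma val_CB: "val e \<in> CBb_plus \<B>"
proof (induction e)
  case (Cutoff n)
  show ?case by (simp add: g_CB)
next
  case (Tail n j k)
  show ?case
    unfolding val.simps w_def
    by (rule CBb_plus_dominated[OF bnd g_CB[of n], of _ 1])
       (auto intro!: continuous_intros g_cont simp: g_nonneg infdist_nonneg)
next
  case (Hat n i r)
  show ?case
    unfolding val.simps hat_def
    by (rule CBb_plus_dominated[OF bnd g_CB[of n], of _ 1])
       (auto intro!: continuous_intros g_cont simp: g_nonneg)
next
  case (Sum a b)
  then show ?case by (simp add: CBb_plus_add[OF bnd])
next
  case (Monus a b)
  show ?case
    unfolding val.simps
    by (rule CBb_plus_dominated[OF bnd Monus.IH(1), of _ 1])
       (use Monus.IH in \<open>auto intro!: continuous_intros simp: CBb_plusD\<close>)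
next
  case (Trunc q a)
  show ?case
    unfolding val.simps
    by (rule CBb_plus_dominated[OF bnd Trunc.IH, of _ 1])
       (use Trunc.IH in \<open>auto intro!: continuous_intros simp: CBb_plusD\<close>)
qed

lemma P_CB: "f \<in> P \<Longrightarrow> f \<in> CBb_plus \<B>"
  using val_CB by blast

sublocale truncation_cone P
proof
  have "(\<lambda>_. 0) = val (Monus (Cutoff 0) (Cutoff 0))" by simp
  then show "(\<lambda>_. 0) \<in> P" by (metis rangeI)
next
  fix f h assume "f \<in> P" "h \<in> P"
  then obtain a b where "f = val a" "h = val b" by blast
  then have "(\<lambda>x. f x + h x) = val (Sum a b)" "(\<lambda>x. max 0 (f x - h x)) = val (Monus a b)"
    by auto
  then show "(\<lambda>x. f x + h x) \<in> P" "(\<lambda>x. max 0 (f x - h x)) \<in> P"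
    by (metis rangeI)+
next
  fix f and q :: real assume "f \<in> P" "q \<in> \<rat>" "0 \<le> q"
  then obtain a t where "f = val a" "q = of_rat t"
    by (auto elim: Rats_cases)
  with \<open>0 \<le> q\<close> have "(\<lambda>x. min (f x) q) = val (Trunc t a)"
    by auto
  then show "(\<lambda>x. min (f x) q) \<in> P" by (metis rangeI)
next
  show "0 \<le> f x" if "f \<in> P" for f x
    using CBb_plusD(1)[OF P_CB[OF that]] .
qed

lemma countable_P: "countable P"
  by simp

section \<open>Approximation from below by the countable family\<close>

lemma bump:
  assumes "open W" "x \<in> W" "q \<in> \<rat>" "0 \<le> q"
  shows "\<exists>p\<in>P. p x = q \<and> (\<forall>y. p y \<le> q) \<and> (\<forall>y. y \<notin> W \<longrightarrow> p y = 0)"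
proof -
  obtain n where n: "x \<in> U n" using U_cover by blast
  obtain e where e: "0 < e" "ball x e \<subseteq> W"
    using assms(1,2) openE by blast
  \<comment> \<open>The centre \<open>s i\<close> lies within \<open>1 / r\<close> of
    \<open>x\<close> and the hat has radius \<open>2 / r\<close>, so \<open>3 / r < e\<close> keeps
    its positive values inside \<open>W\<close>.\<close>
  obtain r :: nat where "3 / e < real r" using reals_Archimedean2 by blast
  then have r: "3 < real r * e" "0 < real r"
    using \<open>0 < e\<close> by (simp add: field_simps, smt (verit) divide_pos_pos)
  obtain i where "s i \<in> ball x (1 / real r)"
    using s_dense[of "ball x (1 / real r)"] r by auto
  then have i: "real r * dist x (s i) < 1"
    using r by (simp add: field_simps)
  obtain N :: nat where N: "q \<le> real N" using real_arch_simple by blast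
  have one: "hat n i r x = 1"
    using i g_one[OF n] by (simp add: hat_def)
  have out: "hat n i r y = 0" if "y \<notin> W" for y
  proof -
    have "e \<le> dist x y" using that e(2) by (auto simp: not_less)
    then have "real r * e \<le> real r * (dist x (s i) + dist y (s i))"
      using r dist_triangle2[of x y "s i"] by (intro mult_left_mono) auto
    then have "2 - real r * dist y (s i) \<le> 0"
      using r i by (simp add: algebra_simps)
    then show ?thesis using g_nonneg[of n y] by (simp add: hat_def max_absorb1 min_absorb2)
  qed
  \<comment> \<open>The factor \<open>N\<close> lifts the value 1 at \<open>x\<close> to at least
    \<open>q\<close>; truncating at the rational \<open>q\<close> then gives exactly
    \<open>q\<close>.\<close>
  have "(\<lambda>y. min (real N * hat n i r y) q) \<in> P"
    by (intro trunc scale P_base assms)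
  then show ?thesis
    using one out N \<open>0 \<le> q\<close> by (intro bexI[of _ "\<lambda>y. min (real N * hat n i r y) q"]) auto
qed

text \<open>Running maxima of the countably many members of \<open>P\<close> below \<open>h\<close>
  increase to \<open>h\<close>, so monotone convergence applies. Lower semicontinuity is the right
  generality: it covers indicators of open sets as well as test functions.\<close>

lemma lower_approximation:
  fixes h :: "'a \<Rightarrow> real"
  assumes lsc: "\<And>c. open {x. c < h x}" and h: "\<And>x. 0 \<le> h x"
    and sets: "sets \<mu> = sets borel" and c: "c < (\<integral>\<^sup>+x. ennreal (h x) \<partial>\<mu>)"
  shows "\<exists>p\<in>P. (\<forall>x. p x \<le> h x) \<and> c < (\<integral>\<^sup>+x. ennreal (p x) \<partial>\<mu>)"
proof -
  define Q where "Q = {p\<in>P. \<forall>x. p x \<le> h x}"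
  have "(\<lambda>_. 0) \<in> Q"
    using zero h unfolding Q_def by simp
  then have Q: "countable Q" "Q \<noteq> {}"
    using countable_subset[OF _ countable_P, of Q] unfolding Q_def by blast+
  define m where "m = rec_nat (from_nat_into Q 0) (\<lambda>n f x. max (f x) (from_nat_into Q (Suc n) x))"
  have m_Suc: "m (Suc n) = (\<lambda>x. max (m n x) (from_nat_into Q (Suc n) x))" for n
    by (simp add: m_def)
  have fQ: "from_nat_into Q n \<in> Q" for n
    by (rule from_nat_into[OF Q(2)])
  have mQ: "m n \<in> Q" for n
  proof (induction n)
    case 0
    show ?case using fQ[of 0] by (simp add: m_def)
  next
    case (Suc n)
    then show ?case using fQ[of "Suc n"] maximum by (simp add: Q_def m_Suc)
  qed
  have m_ge: "from_nat_into Q n x \<le> m n x" for n x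
    by (cases n) (auto simp: m_def)
  have inc: "incseq (\<lambda>n x. ennreal (m n x))"
    by (intro incseq_SucI) (auto simp: le_fun_def m_Suc intro: ennreal_leI)
  have sup: "(SUP n. ennreal (m n x)) = ennreal (h x)" for x
  proof (rule antisym)
    show "(SUP n. ennreal (m n x)) \<le> ennreal (h x)"
      using mQ by (intro SUP_least ennreal_leI) (auto simp: Q_def)
    show "ennreal (h x) \<le> (SUP n. ennreal (m n x))"
    proof (rule ennreal_le_epsilon)
      fix e :: real assume "0 < e"
      show "ennreal (h x) \<le> (SUP n. ennreal (m n x)) + ennreal e"
      proof (cases "h x \<le> e")
        case True
        then show ?thesis by (simp add: add_increasing ennreal_leI)
      next
        case False
        then obtain q where q: "q \<in> \<rat>" "h x - e < q" "q < h x"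
          using Rats_dense_in_real[of "h x - e" "h x"] \<open>0 < e\<close> by auto
        \<comment> \<open>A bump of height \<open>q\<close> living on the open set
          \<open>{y. q < h y}\<close> stays below \<open>h\<close> and comes within \<open>e\<close>
          of it at \<open>x\<close>.\<close>
        then obtain p where p: "p \<in> P" "p x = q" "\<And>y. p y \<le> q" "\<And>y. \<not> q < h y \<Longrightarrow> p y = 0"
          using bump[OF lsc[of q], of x q] False by auto
        have "p y \<le> h y" for y
          using p(3,4)[of y] h[of y] by (cases "q < h y") auto
        then have "p \<in> Q" using p(1) by (simp add: Q_def)
        then obtain n where n: "from_nat_into Q n = p"
          using from_nat_into_surj[OF Q(1)] by blast
        have "ennreal q \<le> (SUP n. ennreal (m n x))"
          using m_ge[of n x] n p(2) by (intro SUP_upper2[of n]) (auto intro: ennreal_leI)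
        moreover have "ennreal (h x) \<le> ennreal q + ennreal e"
          using q False \<open>0 < e\<close> by (subst ennreal_plus[symmetric]) (auto intro: ennreal_leI simp del: ennreal_plus)
        ultimately show ?thesis
          by (meson add_right_mono order_trans)
      qed
    qed
  qed
  have "(\<integral>\<^sup>+x. ennreal (h x) \<partial>\<mu>) = (SUP n. \<integral>\<^sup>+x. ennreal (m n x) \<partial>\<mu>)"
    unfolding sup[symmetric]
  proof (rule nn_integral_monotone_convergence_SUP[OF inc])
    fix n
    have "m n \<in> borel_measurable \<mu>"
      using mQ[of n] CBb_plusD(2)[OF P_CB] sets
      by (intro borel_measurable_if_sets_borel) (auto simp: Q_def)
    then show "(\<lambda>x. ennreal (m n x)) \<in> borel_measurable \<mu>" by simp
  qed
  with c obtain n where "c < (\<integral>\<^sup>+x. ennreal (m n x) \<partial>\<mu>)"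
    by (auto simp: less_SUP_iff)
  then show ?thesis using mQ[of n] unfolding Q_def by blast
qed

text \<open>Approximating indicators of open sets from below gives agreement on open sets. These
  form an intersection-stable generator, and the \<open>U n\<close> cover the space with finite
  measure.\<close>

lemma measure_eqI_P:
  assumes \<mu>: "\<mu> \<in> M" and \<nu>: "\<nu> \<in> M" and eq: "\<And>p. p \<in> P \<Longrightarrow> (\<integral>x. p x \<partial>\<mu>) = (\<integral>x. p x \<partial>\<nu>)"
  shows "\<mu> = \<nu>"
proof -
  have le: "emeasure \<mu> W \<le> emeasure \<nu> W"
    if W: "open W" and \<mu>: "\<mu> \<in> M" and \<nu>: "\<nu> \<in> M"
      and eq: "\<And>p. p \<in> P \<Longrightarrow> (\<integral>x. p x \<partial>\<mu>) = (\<integral>x. p x \<partial>\<nu>)" for W \<mu> \<nu>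
  proof (rule ccontr)
    assume "\<not> ?thesis"
    then have less: "emeasure \<nu> W < emeasure \<mu> W" by simp
    have sets: "sets \<mu> = sets borel" "sets \<nu> = sets borel"
      using \<mu> \<nu> by (auto simp: locally_finite_measures_def)
    have ind: "(\<integral>\<^sup>+x. ennreal (indicator W x) \<partial>\<rho>) = emeasure \<rho> W"
      if "sets \<rho> = sets borel" for \<rho>
      using W that by (simp add: ennreal_indicator)
    have "open {x. c < (indicator W x :: real)}" for c
    proof -
      have "{x. c < (indicator W x :: real)} = (if c < 0 then UNIV else if c < 1 then W else {})"
        by (auto simp: indicator_def)
      then show ?thesis using W by simp
    qed
    then obtain p where p: "p \<in> P" "\<And>x. p x \<le> indicator W x"
        "emeasure \<nu> W < (\<integral>\<^sup>+x. ennreal (p x) \<partial>\<mu>)"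
      using lower_approximation[of "indicator W" \<mu> "emeasure \<nu> W"] less sets ind by auto
    have "(\<integral>\<^sup>+x. ennreal (p x) \<partial>\<mu>) = (\<integral>\<^sup>+x. ennreal (p x) \<partial>\<nu>)"
      using eq[OF p(1)] nn_integral_CBb_plus[OF P_CB[OF p(1)]] \<mu> \<nu> by simp
    also have "\<dots> \<le> (\<integral>\<^sup>+x. ennreal (indicator W x) \<partial>\<nu>)"
      using p(2) by (intro nn_integral_mono ennreal_leI) auto
    also have "\<dots> = emeasure \<nu> W"
      using ind sets by blast
    finally show False using p(3) by simp
  qed
  show ?thesis
  proof (rule measure_eqI_generator_eq[where E = "Collect open" and \<Omega> = UNIV and A = U])
    show "emeasure \<mu> W = emeasure \<nu> W" if "W \<in> Collect open" for W
      using le[of W \<mu> \<nu>] le[of W \<nu> \<mu>] that \<mu> \<nu> eq by (auto intro: antisym)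
    show "sets \<mu> = sigma_sets UNIV (Collect open)" "sets \<nu> = sigma_sets UNIV (Collect open)"
      using \<mu> \<nu> by (simp_all add: locally_finite_measures_def borel_def)
    show "emeasure \<mu> (U i) \<noteq> \<infinity>" for i
      using \<mu> U_in[of i] by (auto simp: locally_finite_measures_def)
  qed (use U_open U_cover in \<open>auto simp: Int_stable_def\<close>)
qed

section \<open>Embedding into the space of real sequences\<close>

definition p :: "nat \<Rightarrow> 'a \<Rightarrow> real" where
  "p = from_nat_into P"

lemma range_p: "range p = P"
  unfolding p_def by (rule range_from_nat_into) auto

lemma P_enum:
  assumes "f \<in> P"
  obtains k where "f = p k"
  using assms unfolding range_p[symmetric] by blast

definition evals :: "'a measure \<Rightarrow> nat \<Rightarrow> real" where
  "evals \<mu> k = (\<integral>x. p k x \<partial>\<mu>)"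

text \<open>The initial topology of the countably many evaluations. Once it is shown to refine the
  vague topology, vaguely open sets become preimages under \<open>evals\<close> of open sets of
  sequences.\<close>

definition eval_topology :: "'a measure topology" where
  "eval_topology = pullback_topology M evals euclidean"

lemma topspace_eval_topology [simp]: "topspace eval_topology = M"
  by (simp add: eval_topology_def topspace_pullback_topology)

lemma continuous_map_eval_P:
  assumes "f \<in> P"
  shows "continuous_map eval_topology euclideanreal (\<lambda>\<mu>. \<integral>x. f x \<partial>\<mu>)"
proof -
  obtain k where "f = p k" using P_enum[OF assms] .
  have "continuous_map euclidean euclideanreal (\<lambda>L :: nat \<Rightarrow> real. L k)"
    by (simp add: continuous_on_product_coordinates)
  then have "continuous_map eval_topology euclideanreal ((\<lambda>L. L k) \<circ> evals)"
    unfolding eval_topology_def by (rule continuous_map_pullback)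
  then show ?thesis
    by (simp add: comp_def evals_def \<open>f = p k\<close>)
qed

text \<open>\<open>f\<close> is the supremum of the members of \<open>P\<close> below it, so its integral is lower semicontinuous;
  upper semicontinuity comes from applying this to \<open>N * g n - f\<close>.\<close>

lemma openin_less_integral:
  assumes f: "f \<in> CBb_plus \<B>" and \<phi>: "continuous_map eval_topology euclideanreal \<phi>"
  shows "openin eval_topology {\<mu>\<in>M. \<phi> \<mu> < (\<integral>x. f x \<partial>\<mu>)}"
proof -
  have "{\<mu>\<in>M. \<phi> \<mu> < (\<integral>x. f x \<partial>\<mu>)}
      = (\<Union>h\<in>{h\<in>P. \<forall>x. h x \<le> f x}. {\<mu>\<in>M. \<phi> \<mu> < (\<integral>x. h x \<partial>\<mu>)})" (is "?A = ?B")
  proof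
    show "?A \<subseteq> ?B"
    proof
      fix \<mu> assume "\<mu> \<in> ?A"
      then have \<mu>: "\<mu> \<in> M" "\<phi> \<mu> < (\<integral>x. f x \<partial>\<mu>)" by auto
      show "\<mu> \<in> ?B"
      proof (cases "\<phi> \<mu> < 0")
        \<comment> \<open>A negative bound would be lost in \<open>ennreal\<close>; the zero
          function already serves as witness.\<close>
        case True
        then show ?thesis
          using \<mu> zero CBb_plusD(1)[OF f] by (intro UN_I[of "\<lambda>_. 0"]) auto
      next
        case False
        have "ennreal (\<phi> \<mu>) < (\<integral>\<^sup>+x. ennreal (f x) \<partial>\<mu>)"
          using \<mu> False by (simp add: nn_integral_CBb_plus[OF f] ennreal_less_iff)
        moreover have "open {x. c < f x}" for c
          using CBb_plusD(2)[OF f] by (intro open_Collect_less continuous_on_const)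
        ultimately obtain h where h: "h \<in> P" "\<And>x. h x \<le> f x" "ennreal (\<phi> \<mu>) < (\<integral>\<^sup>+x. ennreal (h x) \<partial>\<mu>)"
          using lower_approximation[of f \<mu> "ennreal (\<phi> \<mu>)"] CBb_plusD(1)[OF f] \<mu>(1)
          by (auto simp: locally_finite_measures_def)
        then have "\<phi> \<mu> < (\<integral>x. h x \<partial>\<mu>)"
          using False by (simp add: nn_integral_CBb_plus[OF P_CB[OF h(1)] \<mu>(1)] ennreal_less_iff)
        then show ?thesis using h \<mu> by blast
      qed
    qed
    show "?B \<subseteq> ?A"
    proof
      fix \<mu> assume "\<mu> \<in> ?B"
      then obtain h where h: "h \<in> P" "\<forall>x. h x \<le> f x" and \<mu>: "\<mu> \<in> M" "\<phi> \<mu> < (\<integral>x. h x \<partial>\<mu>)"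
        by blast
      have "(\<integral>x. h x \<partial>\<mu>) \<le> (\<integral>x. f x \<partial>\<mu>)"
        using h \<mu> by (intro integral_mono integrable_CBb_plus[OF f] integrable_CBb_plus[OF P_CB]) auto
      with \<mu> show "\<mu> \<in> ?A" by simp
    qed
  qed
  also have "openin eval_topology \<dots>"
  proof (rule openin_Union)
    fix S assume "S \<in> (\<lambda>h. {\<mu>\<in>M. \<phi> \<mu> < (\<integral>x. h x \<partial>\<mu>)}) ` {h\<in>P. \<forall>x. h x \<le> f x}"
    then obtain h where "h \<in> P" and S: "S = {\<mu>\<in>M. \<phi> \<mu> < (\<integral>x. h x \<partial>\<mu>)}"
      by blast
    have "continuous_map eval_topology euclideanreal (\<lambda>\<mu>. (\<integral>x. h x \<partial>\<mu>) - \<phi> \<mu>)"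
      by (intro continuous_map_diff continuous_map_eval_P \<open>h \<in> P\<close> \<phi>)
    then have "openin eval_topology {\<mu>\<in>topspace eval_topology. (\<integral>x. h x \<partial>\<mu>) - \<phi> \<mu> \<in> {0<..}}"
      by (rule openin_continuous_map_preimage) auto
    then show "openin eval_topology S"
      by (simp add: S)
  qed
  finally show ?thesis .
qed

lemma bounded_by_cutoff:
  assumes "f \<in> CBb_plus \<B>"
  obtains n N where "\<And>x. f x \<le> real N * g n x" "\<And>x. f x \<noteq> 0 \<Longrightarrow> x \<in> U n"
proof -
  obtain n where n: "closure {x. f x \<noteq> 0} \<subseteq> U n"
    using U_cofinal[OF CBb_plusD(3)[OF assms]] by blast
  have supp: "x \<in> U n" if "f x \<noteq> 0" for x
    using n that closure_subset[of "{x. f x \<noteq> 0}"] by blast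
  obtain C where C: "\<And>x. f x \<le> C"
    using CBb_plusD(4)[OF assms] by blast
  obtain N :: nat where "C \<le> real N" using real_arch_simple by blast
  have "f x \<le> real N * g n x" for x
  proof (cases "f x = 0")
    case False
    then show ?thesis using C[of x] \<open>C \<le> real N\<close> g_one[OF supp] by simp
  qed (simp add: g_nonneg)
  then show ?thesis using that supp by blast
qed

lemma continuous_map_eval_CBb_plus:
  assumes f: "f \<in> CBb_plus \<B>"
  shows "continuous_map eval_topology euclideanreal (\<lambda>\<mu>. \<integral>x. f x \<partial>\<mu>)"
  unfolding continuous_map_upper_lower_semicontinuous_lt
proof safe
  fix c :: real
  show "openin eval_topology {\<mu> \<in> topspace eval_topology. c < (\<integral>x. f x \<partial>\<mu>)}"
    using openin_less_integral[OF f, of "\<lambda>_. c"] by simp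
  obtain n N where N: "\<And>x. f x \<le> real N * g n x"
    using bounded_by_cutoff[OF f] by metis
  define h where "h x = real N * g n x - f x" for x
  have NP: "(\<lambda>x. real N * g n x) \<in> P"
    by (intro scale P_base)
  have h: "h \<in> CBb_plus \<B>"
    unfolding h_def using N CBb_plusD(1,2)[OF f]
    by (intro CBb_plus_dominated[OF bnd g_CB[of n], of _ "real N"])
       (auto intro!: continuous_intros g_cont)
  have "(\<integral>x. f x \<partial>\<mu>) = (\<integral>x. real N * g n x \<partial>\<mu>) - (\<integral>x. h x \<partial>\<mu>)" if "\<mu> \<in> M" for \<mu>
    using integrable_CBb_plus[OF f that] integrable_CBb_plus[OF P_CB[OF NP] that]
    by (simp add: h_def)
  then have "{\<mu> \<in> topspace eval_topology. (\<integral>x. f x \<partial>\<mu>) < c}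
      = {\<mu>\<in>M. (\<integral>x. real N * g n x \<partial>\<mu>) - c < (\<integral>x. h x \<partial>\<mu>)}"
    by auto
  \<comment> \<open>Here the bound is the continuous map \<open>\<mu>(N * g n) - c\<close>, which is
    why \<open>openin_less_integral\<close> allows a non-constant \<open>\<phi>\<close>.\<close>
  moreover have "openin eval_topology \<dots>"
    by (intro openin_less_integral h continuous_map_diff continuous_map_eval_P NP) auto
  ultimately show "openin eval_topology {\<mu> \<in> topspace eval_topology. (\<integral>x. f x \<partial>\<mu>) < c}"
    by simp
qed

text \<open>Continuity holds because every \<open>p k\<close> is a test function, injectivity
  because \<open>P\<close> determines the measure, and openness because the vague topology is the
  smallest one making all test integrals continuous.\<close>

lemma homeomorphic_map_evals:
  "homeomorphic_map (vague_topology \<B>) (top_of_set (evals ` M)) evals"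
proof (rule bijective_open_imp_homeomorphic_map)
  have "continuous_map (vague_topology \<B>) euclideanreal (\<lambda>\<mu>. evals \<mu> k)" for k
    using range_p unfolding evals_def by (intro continuous_map_vague_topology P_CB) blast
  then have "continuous_map (vague_topology \<B>) euclidean evals"
    using continuous_map_componentwise_UNIV[of "vague_topology \<B>" "\<lambda>_. euclideanreal" evals]
    by (simp add: euclidean_product_topology)
  then show "continuous_map (vague_topology \<B>) (top_of_set (evals ` M)) evals"
    by (auto simp: continuous_map_in_subtopology)
  show "open_map (vague_topology \<B>) (top_of_set (evals ` M)) evals"
    unfolding open_map_def
  proof safe
    fix V assume "openin (vague_topology \<B>) V"
    then have "openin eval_topology V"
      by (rule vague_topology_smallest[rotated 2]) (simp_all add: continuous_map_eval_CBb_plus)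
    then obtain O' where "open O'" "V = evals -` O' \<inter> M"
      unfolding eval_topology_def openin_pullback_topology by auto
    then show "openin (top_of_set (evals ` M)) (evals ` V)"
      by (auto simp: openin_open)
  qed
  show "inj_on evals (topspace (vague_topology \<B>))"
  proof (rule inj_onI)
    fix \<mu> \<nu> assume M: "\<mu> \<in> topspace (vague_topology \<B>)" "\<nu> \<in> topspace (vague_topology \<B>)"
      and "evals \<mu> = evals \<nu>"
    then have eq: "(\<integral>x. p k x \<partial>\<mu>) = (\<integral>x. p k x \<partial>\<nu>)" for k
      by (metis evals_def)
    show "\<mu> = \<nu>"
    proof (rule measure_eqI_P)
      fix f assume "f \<in> P"
      then obtain k where "f = p k" by (rule P_enum)
      then show "(\<integral>x. f x \<partial>\<mu>) = (\<integral>x. f x \<partial>\<nu>)" using eq by simp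
    qed (use M in simp_all)
  qed
qed simp

section \<open>Tight functionals\<close>

lemma infdist_dense_tendsto: "(\<lambda>k. infdist x (s ` {..k})) \<longlonglongrightarrow> 0"
proof (rule LIMSEQ_I)
  fix e :: real assume "0 < e"
  obtain i where i: "s i \<in> ball x e"
    using s_dense[of "ball x e"] \<open>0 < e\<close> by auto
  have "norm (infdist x (s ` {..k}) - 0) < e" if "i \<le> k" for k
    using infdist_le[of "s i" "s ` {..k}" x] i that infdist_nonneg[of x "s ` {..k}"]
    by (simp add: dist_commute)
  then show "\<exists>N. \<forall>k\<ge>N. norm (infdist x (s ` {..k}) - 0) < e" by blast
qed

text \<open>Dominated convergence with majorant \<open>g n\<close>; this supplies the tightness of
  the functionals that come from measures.\<close>

lemma integral_w_tendsto:
  assumes "\<mu> \<in> M"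
  shows "(\<lambda>k. \<integral>x. w n j k x \<partial>\<mu>) \<longlonglongrightarrow> 0"
proof -
  have meas: "f \<in> borel_measurable \<mu>" if "f \<in> CBb_plus \<B>" for f
    using CBb_plusD(2)[OF that] assms
    by (intro borel_measurable_if_sets_borel) (auto simp: locally_finite_measures_def)
  have "(\<lambda>k. \<integral>x. w n j k x \<partial>\<mu>) \<longlonglongrightarrow> (\<integral>x. 0 \<partial>\<mu>)"
  proof (rule integral_dominated_convergence[where w = "g n"])
    show "integrable \<mu> (g n)"
      by (rule integrable_CBb_plus[OF g_CB assms])
    have "(\<lambda>k. w n j k x) \<longlonglongrightarrow> min (g n x) (real j * 0)" for x
      unfolding w_def by (intro tendsto_intros infdist_dense_tendsto)
    then show "AE x in \<mu>. (\<lambda>k. w n j k x) \<longlonglongrightarrow> 0"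
      using g_nonneg[of n] by (simp add: min_absorb2)
    show "AE x in \<mu>. norm (w n j k x) \<le> g n x" for k
      using g_nonneg[of n] by (auto simp: w_def infdist_nonneg)
    show "w n j k \<in> borel_measurable \<mu>" for k
      by (intro meas P_CB P_base)
  qed simp
  then show ?thesis by simp
qed

text \<open>The points of \<open>U n\<close> where all \<open>w n j (k j)\<close> are below \<open>1/2\<close> form a totally bounded set, so
  smallness of \<open>L (w n j (k j))\<close> is a tightness condition.\<close>

lemma w_less_half_cover:
  assumes "w n j k x < 1/2" "x \<in> U n"
  shows "\<exists>y\<in>s ` {..k}. real j * dist x y < 1"
proof (rule ccontr)
  assume "\<not> ?thesis"
  then have far: "\<forall>y\<in>s ` {..k}. 1 \<le> real j * dist x y"
    by (meson not_le)
  \<comment> \<open>The point \<open>s k\<close> is used only to exclude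
    \<open>j = 0\<close>.\<close>
  then have "1 \<le> real j * dist x (s k)" by blast
  then have j: "0 < real j" by (cases j) auto
  have "1 / real j \<le> infdist x (s ` {..k})"
  proof -
    have "1 / real j \<le> (INF y\<in>s ` {..k}. dist x y)"
      using far j by (intro cINF_greatest) (auto simp: field_simps)
    then show ?thesis by (subst infdist_notempty) auto
  qed
  then have "1 \<le> real j * infdist x (s ` {..k})"
    using j by (simp add: field_simps)
  then show False
    using assms(1) g_one[OF assms(2)] by (simp add: w_def)
qed

text \<open>A Dini argument. Counterexamples \<open>x i\<close> for all \<open>i\<close> would be
  points where every \<open>w n j (k j)\<close> with \<open>j < i\<close> is below
  \<open>1/2\<close>, so they form a totally bounded sequence. At a limit \<open>l\<close> of a
  subsequence, all \<open>F q l\<close> would be at least \<open>1 / m\<close>, contradicting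
  convergence to 0.\<close>

lemma tight_pointwise_bound:
  fixes F :: "nat \<Rightarrow> 'a \<Rightarrow> real" and m N :: nat
  assumes F: "\<And>i. F i \<in> P" and dec: "\<And>x. decseq (\<lambda>i. F i x)" and lim: "\<And>x. (\<lambda>i. F i x) \<longlonglongrightarrow> 0"
    and supp: "\<And>x. F 0 x \<noteq> 0 \<Longrightarrow> x \<in> U n" and N: "\<And>x. F 0 x \<le> real N"
    and m: "0 < m"
  shows "\<exists>i. \<forall>x. real m * F i x \<le> g n x + (\<Sum>j<i. real (2 * N * m) * w n j (k j) x)"
proof (rule ccontr)
  assume "\<not> ?thesis"
  then have "\<forall>i. \<exists>x. g n x + (\<Sum>j<i. real (2 * N * m) * w n j (k j) x) < real m * F i x"
    by (simp only: not_ex not_all not_le simp_thms)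
  from choice[OF this] obtain x
    where x: "\<And>i. g n (x i) + (\<Sum>j<i. real (2 * N * m) * w n j (k j) (x i)) < real m * F i (x i)"
    by blast
  have w_nonneg: "0 \<le> w n j (k j) y" for j y
    using nonneg[OF P_base(2)] .
  have le0: "F i y \<le> F 0 y" for i y
    using dec[of y] by (simp add: decseq_def)
  have sum_nonneg': "0 \<le> (\<Sum>j<i. real (2 * N * m) * w n j (k j) (x i))" for i
    by (intro sum_nonneg mult_nonneg_nonneg w_nonneg) auto
  then have pos: "0 < real m * F i (x i)" for i
    using x[of i] g_nonneg[of n "x i"] by (meson add_nonneg_nonneg order_le_less_trans)
  then have Fpos: "0 < F i (x i)" for i
    using m by (simp add: zero_less_mult_iff)
  have xU: "x i \<in> U n" for i
    using supp[of "x i"] Fpos[of i] le0[of i "x i"] by fastforce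
  have x1: "1 + (\<Sum>j<i. real (2 * N * m) * w n j (k j) (x i)) < real m * F i (x i)" for i
    using x[of i] g_one[OF xU] by simp
  have F_lower: "1 < real m * F i (x i)" for i
    using x1[of i] sum_nonneg'[of i] by linarith
  have "0 < N"
    using Fpos[of 0] N[of "x 0"] by (cases N) auto
  \<comment> \<open>The factor \<open>2 * N * m\<close> is calibrated here: each weighted term is
    below \<open>m * F i (x i)\<close>, hence below \<open>m * N\<close>.\<close>
  have w_half: "w n j (k j) (x i) < 1/2" if "j < i" for i j
  proof -
    have "real (2 * N * m) * w n j (k j) (x i) \<le> (\<Sum>j<i. real (2 * N * m) * w n j (k j) (x i))"
      using that w_nonneg by (intro member_le_sum) auto
    also have "\<dots> < real m * F i (x i)"
      using x1[of i] by linarith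
    also have "\<dots> \<le> real m * real N"
      using le0[of i "x i"] N[of "x i"] by (intro mult_left_mono) auto
    finally have "real N * real m * (2 * w n j (k j) (x i)) < real N * real m * 1"
      by (simp add: algebra_simps)
    then show ?thesis
      using \<open>0 < N\<close> m by (subst (asm) mult_less_cancel_left_pos) auto
  qed
  have "\<exists>K. finite K \<and> (\<forall>i. \<exists>y\<in>K. dist (x i) y < e)" if "0 < e" for e
  proof -
    obtain j :: nat where j: "1 / e < real j" using reals_Archimedean2 by blast
    have "0 < real j" using j \<open>0 < e\<close> by (smt (verit) divide_pos_pos)
    \<comment> \<open>The half bound at scale \<open>j\<close> is available only for
      \<open>i > j\<close>; the finitely many earlier points serve as their own centres.\<close>
    have "\<exists>y\<in>s ` {..k j} \<union> x ` {..j}. dist (x i) y < e" for i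
    proof (cases "j < i")
      case True
      obtain y where y: "y \<in> s ` {..k j}" "real j * dist (x i) y < 1"
        using w_less_half_cover[OF w_half[OF True] xU] by blast
      have "1 < real j * e" using j \<open>0 < e\<close> by (simp add: field_simps)
      with y(2) have "real j * dist (x i) y < real j * e" by linarith
      then have "dist (x i) y < e" using \<open>0 < real j\<close> by simp
      then show ?thesis using y(1) by blast
    next
      case False
      then show ?thesis using \<open>0 < e\<close> by (intro bexI[of _ "x i"]) auto
    qed
    then show ?thesis by (intro exI[of _ "s ` {..k j} \<union> x ` {..j}"]) blast
  qed
  then obtain l r where r: "strict_mono r" "(x \<circ> r) \<longlonglongrightarrow> l"
    by (rule convergent_subseq_if_totally_bounded)
  have "1 \<le> real m * F q l" for q
  proof (rule LIMSEQ_le_const)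
    have "continuous_on UNIV (F q)"
      by (rule CBb_plusD(2)[OF P_CB[OF F]])
    then have "(\<lambda>i. F q ((x \<circ> r) i)) \<longlonglongrightarrow> F q l"
      by (rule continuous_on_tendsto_compose[OF _ r(2)]) auto
    then show "(\<lambda>i. real m * F q ((x \<circ> r) i)) \<longlonglongrightarrow> real m * F q l"
      by (intro tendsto_mult tendsto_const)
    have "1 \<le> real m * F q ((x \<circ> r) i)" if "q \<le> i" for i
    proof -
      have "q \<le> r i" using that seq_suble[OF r(1), of i] by linarith
      then have "F (r i) (x (r i)) \<le> F q (x (r i))"
        using dec[of "x (r i)"] by (simp add: decseq_def)
      then have "real m * F (r i) (x (r i)) \<le> real m * F q (x (r i))"
        by (intro mult_left_mono) auto
      then show ?thesis using F_lower[of "r i"] by simp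
    qed
    then show "\<exists>q'. \<forall>i\<ge>q'. 1 \<le> real m * F q ((x \<circ> r) i)" by blast
  qed
  moreover have "(\<lambda>q. real m * F q l) \<longlonglongrightarrow> real m * 0"
    by (intro tendsto_mult tendsto_const lim)
  ultimately show False
    using LIMSEQ_le_const[of "\<lambda>q. real m * F q l" 0 1] by auto
qed

text \<open>Applying \<open>L\<close> to the pointwise bound gives
  \<open>m * L (F i) \<le> L (g n) + 2 * N\<close>, where \<open>m\<close> is arbitrary and the
  right side does not depend on it.\<close>

lemma daniell_functional_if_tight:
  assumes L_nonneg: "\<And>f. f \<in> P \<Longrightarrow> 0 \<le> L f"
    and L_add: "\<And>f h. f \<in> P \<Longrightarrow> h \<in> P \<Longrightarrow> L (\<lambda>x. f x + h x) = L f + L h"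
    and tight: "\<And>n j \<delta>. 0 < \<delta> \<Longrightarrow> \<exists>k. L (w n j k) < \<delta>"
  shows "daniell_functional P L"
proof -
  interpret L: additive_functional P L
    using L_nonneg L_add by unfold_locales
  show ?thesis
  proof
    show "countable P" by simp
    show "\<exists>C. \<forall>x. f x \<le> C" "continuous_on UNIV f" if "f \<in> P" for f
      using CBb_plusD[OF P_CB[OF that]] by auto
    show "\<exists>f\<in>P. 0 < f x \<and> {x. 0 < f x} \<subseteq> W" if W: "open W" "x \<in> W" for W x
    proof -
      obtain f where f: "f \<in> P" "f x = 1" "\<forall>y. y \<notin> W \<longrightarrow> f y = 0"
        using bump[OF W Rats_1 zero_le_one] by blast
      have "{x. 0 < f x} \<subseteq> W"
        using f(3) by (metis less_irrefl mem_Collect_eq subsetI)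
      then show ?thesis using f(1,2) by (metis zero_less_one)
    qed
    fix F :: "nat \<Rightarrow> 'a \<Rightarrow> real"
    assume F: "\<And>i. F i \<in> P" and dec: "\<And>x. decseq (\<lambda>i. F i x)" and lim: "\<And>x. (\<lambda>i. F i x) \<longlonglongrightarrow> 0"
    obtain n N where N: "\<And>x. F 0 x \<le> real N * g n x" and supp: "\<And>x. F 0 x \<noteq> 0 \<Longrightarrow> x \<in> U n"
      using bounded_by_cutoff[OF P_CB[OF F]] by metis
    have N': "F 0 x \<le> real N" for x
      using N[of x] mult_left_mono[OF g_le[of n x], of "real N"] by simp
    show "(\<lambda>i. L (F i)) \<longlonglongrightarrow> 0"
    proof (rule LIMSEQ_I)
      fix e :: real assume "0 < e"
      obtain m :: nat where m: "(L (g n) + 2 * real N) / e < real m" using reals_Archimedean2 by blast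
      have "0 \<le> (L (g n) + 2 * real N) / e"
        using L_nonneg[OF P_base(1)] \<open>0 < e\<close> by simp
      then have "0 < m" using m by (simp only: of_nat_0_less_iff[symmetric])
      \<comment> \<open>Dividing by \<open>m\<close> cancels the \<open>m\<close> in the weights
        \<open>2 * N * m\<close>, and the powers of \<open>1/2\<close> sum to at most 1, leaving
        \<open>2 * N\<close>.\<close>
      have "\<exists>k. L (w n j k) < (1/2) ^ Suc j / real m" for j
        using \<open>0 < m\<close> by (intro tight) simp
      then obtain k where k: "\<And>j. L (w n j (k j)) < (1/2) ^ Suc j / real m" by metis
      obtain i where i: "\<And>x. real m * F i x \<le> g n x + (\<Sum>j<i. real (2 * N * m) * w n j (k j) x)"
        using tight_pointwise_bound[OF F dec lim supp N' \<open>0 < m\<close>] by blast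
      have "real m * L (F i) = L (\<lambda>x. real m * F i x)"
        by (rule L.L_scale[OF F, symmetric])
      also have "\<dots> \<le> L (\<lambda>x. g n x + (\<Sum>j<i. real (2 * N * m) * w n j (k j) x))"
        by (intro L.L_mono i scale F add sum_closed P_base)
      also have "\<dots> = L (g n) + L (\<lambda>x. \<Sum>j<i. real (2 * N * m) * w n j (k j) x)"
        by (intro L_add P_base sum_closed scale)
      also have "L (\<lambda>x. \<Sum>j<i. real (2 * N * m) * w n j (k j) x)
          = (\<Sum>j<i. L (\<lambda>x. real (2 * N * m) * w n j (k j) x))"
        by (intro L.L_sum P_base scale)
      also have "\<dots> = (\<Sum>j<i. real (2 * N * m) * L (w n j (k j)))"
        by (simp only: L.L_scale[OF P_base(2)])
      also have "L (g n) + (\<Sum>j<i. real (2 * N * m) * L (w n j (k j)))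
          \<le> L (g n) + (\<Sum>j<i. real (2 * N * m) * ((1/2) ^ Suc j / real m))"
        by (intro add_left_mono sum_mono mult_left_mono less_imp_le[OF k]) auto
      also have "(\<Sum>j<i. real (2 * N * m) * ((1/2) ^ Suc j / real m)) = 2 * real N * (\<Sum>j<i. (1/2) ^ Suc j)"
        using \<open>0 < m\<close> by (simp add: sum_distrib_left)
      also have "\<dots> \<le> 2 * real N * 1"
      proof (intro mult_left_mono)
        show "(\<Sum>j<i. (1/2::real) ^ Suc j) \<le> 1"
          using sum_le_suminf[of "\<lambda>j. (1/2::real) ^ Suc j" "{..<i}"] power_half_series
          by (auto simp: sums_iff)
      qed auto
      finally have "real m * L (F i) \<le> L (g n) + 2 * real N" by simp
      also have "\<dots> < real m * e"
        using m \<open>0 < e\<close> by (simp add: field_simps)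
      finally have Li: "L (F i) < e"
        by (rule mult_left_less_imp_less) simp
      have "norm (L (F q) - 0) < e" if "i \<le> q" for q
      proof -
        have "L (F q) \<le> L (F i)"
          using dec that by (intro L.L_mono F) (auto simp: decseq_def)
        then show ?thesis using Li L_nonneg[OF F, of q] by simp
      qed
      then show "\<exists>i. \<forall>q\<ge>i. norm (L (F q) - 0) < e" by blast
    qed
  qed
qed

text \<open>A sequence \<open>L\<close> encodes the functional \<open>p i \<mapsto> L i\<close>.
  Each additivity equation involves only finitely many coordinates, and the bounds
  \<open>1 / (m + 1)\<close> make tightness a countable intersection of open conditions.\<close>

definition tight_functionals :: "(nat \<Rightarrow> real) set" where
  "tight_functionals =
     {L. (\<forall>i. 0 \<le> L i) \<and> (\<forall>i j k. p k = (\<lambda>x. p i x + p j x) \<longrightarrow> L k = L i + L j)} \<inter>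
     (\<Inter>(n, j, m)\<in>UNIV. {L. \<exists>k i. p i = w n j k \<and> L i < 1 / real (Suc m)})"

lemma gdelta_in_tight_functionals: "gdelta_in euclidean tight_functionals"
  unfolding tight_functionals_def
proof (rule gdelta_in_Int)
  have cont: "continuous_on UNIV (\<lambda>L :: nat \<Rightarrow> real. L i)" for i
    by (rule continuous_on_product_coordinates)
  have "closed {L :: nat \<Rightarrow> real. (\<forall>i. 0 \<le> L i) \<and>
      (\<forall>i j k. p k = (\<lambda>x. p i x + p j x) \<longrightarrow> L k = L i + L j)}"
    by (intro closed_Collect_conj closed_Collect_all closed_Collect_imp closed_Collect_le
        closed_Collect_eq continuous_intros cont open_Collect_const)
  then show "gdelta_in euclidean {L :: nat \<Rightarrow> real. (\<forall>i. 0 \<le> L i) \<and>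
      (\<forall>i j k. p k = (\<lambda>x. p i x + p j x) \<longrightarrow> L k = L i + L j)}"
    by (intro closed_imp_gdelta_in metrizable_space_euclidean) simp
  show "gdelta_in euclidean
     (\<Inter>(n, j, m)\<in>UNIV. {L :: nat \<Rightarrow> real. \<exists>k i. p i = w n j k \<and> L i < 1 / real (Suc m)})"
  proof (rule gdelta_in_Inter)
    fix S assume "S \<in> range (\<lambda>(n, j, m). {L :: nat \<Rightarrow> real. \<exists>k i. p i = w n j k \<and> L i < 1 / real (Suc m)})"
    then obtain n j m where S: "S = {L. \<exists>k i. p i = w n j k \<and> L i < 1 / real (Suc m)}"
      by auto
    have "open S"
      unfolding S by (intro open_Collect_ex open_Collect_conj open_Collect_const open_Collect_less
          cont continuous_on_const)
    then show "gdelta_in euclidean S"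
      by (simp add: open_imp_gdelta_in)
  qed auto
qed

lemma evals_in_tight_functionals:
  assumes "\<mu> \<in> M"
  shows "evals \<mu> \<in> tight_functionals"
proof -
  have pP: "p k \<in> P" for k using range_p by blast
  have int: "integrable \<mu> (p k)" for k
    by (intro integrable_CBb_plus[OF _ assms] P_CB pP)
  have "0 \<le> evals \<mu> i" for i
    unfolding evals_def using nonneg[OF pP] by (intro Bochner_Integration.integral_nonneg)
  moreover have "evals \<mu> k = evals \<mu> i + evals \<mu> j" if "p k = (\<lambda>x. p i x + p j x)" for i j k
    using int[of i] int[of j] by (simp add: evals_def that)
  moreover have "\<exists>k i. p i = w n j k \<and> evals \<mu> i < 1 / real (Suc m)" for n j m
  proof -
    have "\<forall>\<^sub>F k in sequentially. (\<integral>x. w n j k x \<partial>\<mu>) < 1 / real (Suc m)"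
      by (rule order_tendstoD(2)[OF integral_w_tendsto[OF assms]]) simp
    then obtain k where k: "(\<integral>x. w n j k x \<partial>\<mu>) < 1 / real (Suc m)"
      by (auto simp: eventually_sequentially)
    obtain i where "w n j k = p i" using P_enum[OF P_base(2)] .
    then show ?thesis using k by (intro exI[of _ k] exI[of _ i]) (simp add: evals_def)
  qed
  ultimately show ?thesis
    unfolding tight_functionals_def by blast
qed

lemma tight_functionals_in_evals:
  assumes "L \<in> tight_functionals"
  shows "L \<in> evals ` M"
proof -
  have L: "0 \<le> L i" "p k = (\<lambda>x. p i x + p j x) \<Longrightarrow> L k = L i + L j"
    and tight: "\<exists>k i. p i = w n j k \<and> L i < 1 / real (Suc m)" for i j k n m
    using assms unfolding tight_functionals_def by blast+
  \<comment> \<open>An index of the zero function: \<open>0 + 0 = 0\<close> forces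
    \<open>L z = 0\<close>, and \<open>p i = p j + 0\<close> then gives \<open>L i = L j\<close>
    whenever \<open>p i = p j\<close>. Thus \<open>L\<close> depends on the function and not on its
    index, which makes the choice in \<open>\<Lambda>\<close> harmless.\<close>
  obtain z where z: "(\<lambda>_. 0) = p z" using P_enum[OF zero] .
  have "L z = 0" using L(2)[of z z z] by (simp flip: z)
  then have L_cong: "L i = L j" if "p i = p j" for i j
    using L(2)[of i j z] that by (simp flip: z)
  define \<Lambda> where "\<Lambda> f = L (SOME i. p i = f)" for f
  have \<Lambda>_p: "\<Lambda> (p i) = L i" for i
    unfolding \<Lambda>_def by (rule L_cong) (rule someI[of _ i], simp)
  interpret D: daniell_functional P \<Lambda>
  proof (rule daniell_functional_if_tight)
    show "0 \<le> \<Lambda> f" for f by (simp add: \<Lambda>_def L)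
    show "\<Lambda> (\<lambda>x. f x + h x) = \<Lambda> f + \<Lambda> h" if f: "f \<in> P" and h: "h \<in> P" for f h
    proof -
      obtain i where i: "f = p i" using P_enum[OF f] .
      obtain j where j: "h = p j" using P_enum[OF h] .
      obtain k where k: "(\<lambda>x. f x + h x) = p k" using P_enum[OF add[OF f h]] .
      have "L k = L i + L j"
        using k by (intro L(2)) (simp add: i j)
      then show ?thesis unfolding k unfolding i j \<Lambda>_p .
    qed
    show "\<exists>k. \<Lambda> (w n j k) < \<delta>" if \<delta>: "0 < \<delta>" for n j and \<delta> :: real
    proof -
      obtain m where m: "1 / real (Suc m) < \<delta>"
        using reals_Archimedean[OF \<delta>] by (auto simp: inverse_eq_divide)
      obtain k i where "p i = w n j k" "L i < 1 / real (Suc m)"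
        using tight by blast
      then show ?thesis using m \<Lambda>_p[of i] by (intro exI[of _ k]) simp
    qed
  qed
  let ?\<mu> = "D.representing_measure"
  \<comment> \<open>A bounded set lies in some \<open>U n\<close>, whose indicator is below
    \<open>g n\<close>, and \<open>g n\<close> has finite integral
    \<open>\<Lambda> (g n)\<close>.\<close>
  have "emeasure ?\<mu> B < \<infinity>" if B: "B \<in> \<B>" for B
  proof -
    obtain n where n: "B \<subseteq> U n" using U_cofinal[OF B] by blast
    have "emeasure ?\<mu> B \<le> emeasure ?\<mu> (U n)"
      using U_open by (intro emeasure_mono n) auto
    also have "\<dots> = (\<integral>\<^sup>+x. indicator (U n) x \<partial>?\<mu>)"
      using U_open[of n] by simp
    also have "\<dots> \<le> (\<integral>\<^sup>+x. ennreal (g n x) \<partial>?\<mu>)"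
      by (intro nn_integral_mono) (auto simp: indicator_def g_one)
    also have "\<dots> = ennreal (\<Lambda> (g n))"
      by (rule D.nn_integral_representing_measure[OF P_base(1)])
    finally show ?thesis by (simp add: le_less_trans)
  qed
  then have "?\<mu> \<in> M"
    by (simp add: locally_finite_measures_def)
  moreover have "evals ?\<mu> k = L k" for k
  proof -
    have "p k \<in> P" using range_p by blast
    then show ?thesis
      by (simp add: evals_def D.integral_representing_measure \<Lambda>_p)
  qed
  then have "L = evals ?\<mu>" by (simp add: fun_eq_iff)
  ultimately show ?thesis by blast
qed

lemma evals_image: "evals ` M = tight_functionals"
  using evals_in_tight_functionals tight_functionals_in_evals by blast

theorem polish_vague_topology: "polish_topology (vague_topology \<B>)"
proof -
  have hom: "vague_topology \<B> homeomorphic_space top_of_set tight_functionals"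
    using homeomorphic_map_imp_homeomorphic_space[OF homeomorphic_map_evals] by (simp only: evals_image)
  have "completely_metrizable_space (top_of_set tight_functionals)"
    by (intro completely_metrizable_space_gdelta_in completely_metrizable_space_euclidean
        gdelta_in_tight_functionals)
  then have "completely_metrizable_space (vague_topology \<B>)"
    using homeomorphic_completely_metrizable_space[OF hom] by simp
  \<comment> \<open>Second countability is transferred because, unlike separability, it passes to
    arbitrary subspaces; separability is recovered at the end.\<close>
  moreover have "second_countable (euclidean :: (nat \<Rightarrow> real) topology)"
  proof -
    obtain A :: "(nat \<Rightarrow> real) set set" where A: "countable A" "topological_basis A"
      using ex_countable_basis by blast
    then show ?thesis
      unfolding second_countable_def
      by (intro exI[of _ A]) (auto intro: topological_basis_open elim: topological_basisE)
  qed
  then have "second_countable (top_of_set tight_functionals)"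
    by (rule second_countable_subtopology)
  then have "second_countable (vague_topology \<B>)"
    using homeomorphic_space_second_countability[OF hom] by simp
  ultimately show ?thesis
    using second_countable_imp_separable_space by (simp add: polish_topology_def)
qed

end

theorem proposition3p1:
  fixes \<B> :: "'a::polish_space set set"
  assumes "boundedness \<B>"
    and "properly_localizes \<B>"
  shows "metrizable_space (vague_topology \<B>) \<and> polish_topology (vague_topology \<B>)"
proof -
  obtain U :: "nat \<Rightarrow> 'a set" where U: "\<And>n. open (U n)" "\<And>n. U n \<in> \<B>" "\<And>n. closure (U n) \<subseteq> U (Suc n)"
      "\<And>B. B \<in> \<B> \<Longrightarrow> \<exists>n. B \<subseteq> U n" "\<And>x. \<exists>n. x \<in> U n"
    using localizing_exhaustion[OF assms] by blast
  obtain g where g: "\<And>n. g n \<in> CBb_plus \<B>" "\<And>n x. g n x \<le> 1" "\<And>n x. x \<in> U n \<Longrightarrow> g n x = 1"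
    using localizing_cutoff[of \<B> U, OF assms(1) U(1-3)] by metis
  \<comment> \<open>An enumeration of a countable dense set provides the sequence \<open>s\<close>
    of the locale.\<close>
  obtain D :: "'a set" where D: "countable D" "\<And>W. open W \<Longrightarrow> W \<noteq> {} \<Longrightarrow> \<exists>d\<in>D. d \<in> W"
    using countable_dense_setE by metis
  have "\<exists>i. from_nat_into D i \<in> W" if "open W" "W \<noteq> {}" for W
    using D(2)[OF that] from_nat_into_surj[OF D(1)] by metis
  then interpret localization \<B> U g "from_nat_into D"
    using assms(1) U g by unfold_locales auto
  show ?thesis
    using polish_vague_topology completely_metrizable_imp_metrizable_space
    by (auto simp: polish_topology_def)
qed

end
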